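(* Let $\Omega\subset \mathbb{C}^d$, $d\geq 2$, be a bounded domain having either one of the following properties: (1) $\Omega$ is a convex Goldilocks domain; or (2) $\Omega$ is a smoothly bounded strongly linearly convex domain. Then every complex geodesic $\varphi : \Delta\rightarrow \Omega$ extends to a continuous map $\widetilde{\varphi}: \overline{\Delta}\rightarrow \overline{\Omega}$.
   Context: $\Delta\subset\mathbb{C}$ is the open unit disc. For a bounded domain $\Omega \subset \mathbb{C}^d$: $K_\Omega$ is the Kobayashi distance on $\Omega$; $k_\Omega(x;v)$ ($x\in\Omega$, $v\in\mathbb{C}^d$) is the infinitesimal Kobayashi (Kobayashi--Royden) metric (normalised so that $k_\Delta(\zeta;1)=1/(1-|\zeta|^2)$ and $K_\Delta$ is the corresponding Poincaré distance); $\|\cdot\|$ is the Euclidean norm; $\delta_\Omega(x)$ is the Euclidean distance from $x$ to $\partial\Omega$. Define $$M_\Omega(r) := \sup\left\{ \frac{1}{k_{\Omega}(x;v)} : \delta_\Omega(x) \leq r, \|v\|=1\right\}.$$ A bounded domain $\Omega \subset \mathbb{C}^d$ is a Goldilocks domain if (1) for some (hence any) $\epsilon >0$, $\int_0^\epsilon \frac{1}{r} M_\Omega(r)\, dr < \infty$; and (2) for each $x_0 \in \Omega$ there exist constants $C, \alpha > 0$ (depending on $x_0$) such that $K_\Omega(x_0, x) \leq C + \alpha \log \frac{1}{\delta_\Omega(x)}$ for all $x \in \Omega$. A complex geodesic of $\Omega$ is a holomorphic map $\varphi:\Delta\to\Omega$ that is an isometric embedding of $(\Delta,K_\Delta)$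 into $(\Omega,K_\Omega)$. "Smoothly bounded" means bounded with $C^\infty$-smooth boundary. A bounded domain $\Omega\subset\mathbb{C}^d$ with $C^2$ boundary and defining function $r$ is strongly linearly convex if it is linearly convex (through every point of $\mathbb{C}^d\setminus\Omega$ there passes a complex affine hyperplane disjoint from $\Omega$) and, for every $a\in\partial\Omega$ and every nonzero $X\in\mathbb{C}^d$ with $\sum_j \frac{\partial r}{\partial z_j}(a)X_j=0$, one has $\sum_{j,k}\frac{\partial^2 r}{\partial z_j\partial\bar z_k}(a)X_j\overline{X_k} > \left|\sum_{j,k}\frac{\partial^2 r}{\partial z_j\partial z_k}(a)X_jX_k\right|$. *)

theory Defs
  imports "HOL-Analysis.Analysis"
begin

section \<open>Domains and holomorphic discs\<close>

definition bounded_domain :: "(complex ^ 'n) set \<Rightarrow> bool" where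
  "bounded_domain \<Omega> \<longleftrightarrow> open \<Omega> \<and> connected \<Omega> \<and> \<Omega> \<noteq> {} \<and> bounded \<Omega>"

definition boundary_dist :: "(complex ^ 'n) set \<Rightarrow> complex ^ 'n \<Rightarrow> real" where
  "boundary_dist \<Omega> x = infdist x (frontier \<Omega>)"

definition holomorphic_disc :: "(complex ^ 'n) set \<Rightarrow> (complex \<Rightarrow> complex ^ 'n) \<Rightarrow> bool" where
  "holomorphic_disc \<Omega> f \<longleftrightarrow>
     (\<forall>i. (\<lambda>z. f z $ i) holomorphic_on ball 0 1) \<and> f ` ball 0 1 \<subseteq> \<Omega>"

section \<open>The Kobayashi distance and metric\<close>

text \<open>The Poincare distance normalised by the infinitesimal metric
  \<open>|dz| / (1 - |z|^2)\<close>; recall \<open>artanh t = ln ((1 + t) / (1 - t)) / 2\<close>.\<close>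

definition poincare_dist :: "complex \<Rightarrow> complex \<Rightarrow> real" where
  "poincare_dist z w = artanh (cmod ((z - w) / (1 - cnj w * z)))"

text \<open>The Kobayashi distance is the infimum of the lengths of all finite chains of holomorphic
  discs \<open>f 0, \<dots>, f (n - 1)\<close> joining \<open>x = p 0, p 1, \<dots>, p n = y\<close>.
  For points of a domain such chains exist, and the infimum is over a nonempty set.\<close>

definition kobayashi_dist ::
  "(complex ^ 'n) set \<Rightarrow> complex ^ 'n \<Rightarrow> complex ^ 'n \<Rightarrow> real" where
  "kobayashi_dist \<Omega> x y =
     Inf {(\<Sum>j<n. poincare_dist (a j) (b j)) | n p f a b.
            p 0 = x \<and> p n = y \<and>
            (\<forall>j<n. holomorphic_disc \<Omega> (f j) \<and> a j \<in> ball 0 1 \<and> b j \<in> ball 0 1 \<and>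
                   f j (a j) = p j \<and> f j (b j) = p (Suc j))}"

text \<open>The Kobayashi--Royden metric: the infimum of \<open>|\<xi>|\<close> over all holomorphic discs \<open>f\<close> with
  \<open>f 0 = x\<close> and \<open>df(0) \<xi> = v\<close>.\<close>

definition kobayashi_metric ::
  "(complex ^ 'n) set \<Rightarrow> complex ^ 'n \<Rightarrow> complex ^ 'n \<Rightarrow> real" where
  "kobayashi_metric \<Omega> x v =
     Inf {cmod \<xi> | \<xi> f. holomorphic_disc \<Omega> f \<and> f 0 = x \<and>
                       (\<forall>i. deriv (\<lambda>z. f z $ i) 0 * \<xi> = v $ i)}"

definition complex_geodesic :: "(complex ^ 'n) set \<Rightarrow> (complex \<Rightarrow> complex ^ 'n) \<Rightarrow> bool" where
  "complex_geodesic \<Omega> \<phi> \<longleftrightarrow> holomorphic_disc \<Omega> \<phi> \<and>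
     (\<forall>z\<in>ball 0 1. \<forall>w\<in>ball 0 1. kobayashi_dist \<Omega> (\<phi> z) (\<phi> w) = poincare_dist z w)"

section \<open>Goldilocks domains\<close>

text \<open>The supremum and the integral below are taken in \<^typ>\<open>ennreal\<close>, where \<open>1 / 0 = \<infinity>\<close> and
  suprema always exist, so no junk values can arise.  The integrand is Borel measurable because
  \<open>M_Omega \<Omega>\<close> is monotone.\<close>

definition M_Omega :: "(complex ^ 'n) set \<Rightarrow> real \<Rightarrow> ennreal" where
  "M_Omega \<Omega> r =
     Sup {1 / ennreal (kobayashi_metric \<Omega> x v) | x v.
            x \<in> \<Omega> \<and> boundary_dist \<Omega> x \<le> r \<and> norm v = 1}"

definition goldilocks :: "(complex ^ 'n) set \<Rightarrow> bool" where
  "goldilocks \<Omega> \<longleftrightarrow> bounded_domain \<Omega> \<and>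
     (\<exists>\<epsilon>>0. (\<integral>\<^sup>+r\<in>{0<..<\<epsilon>}. (1 / ennreal r * M_Omega \<Omega> r) \<partial>lborel) < \<infinity>) \<and>
     (\<forall>x0\<in>\<Omega>. \<exists>C>0. \<exists>\<alpha>>0. \<forall>x\<in>\<Omega>.
        kobayashi_dist \<Omega> x0 x \<le> C + \<alpha> * ln (1 / boundary_dist \<Omega> x))"

section \<open>Smooth boundaries\<close>

text \<open>\<open>Ck_on k U f\<close> states that \<open>f\<close> is of class \<open>C^k\<close>, in the real sense, on the open set \<open>U\<close>.\<close>

primrec Ck_on ::
  "nat \<Rightarrow> 'a::euclidean_space set \<Rightarrow> ('a \<Rightarrow> 'b::real_normed_vector) \<Rightarrow> bool" where
  "Ck_on 0 U f \<longleftrightarrow> continuous_on U f"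
| "Ck_on (Suc k) U f \<longleftrightarrow>
     (\<forall>x\<in>U. f differentiable (at x)) \<and>
     (\<forall>v. Ck_on k U (\<lambda>x. frechet_derivative f (at x) v))"

definition defining_function ::
  "(complex ^ 'n) set \<Rightarrow> (complex ^ 'n) set \<Rightarrow> (complex ^ 'n \<Rightarrow> real) \<Rightarrow> bool" where
  "defining_function \<Omega> U r \<longleftrightarrow>
     open U \<and> frontier \<Omega> \<subseteq> U \<and>
     \<Omega> \<inter> U = {z\<in>U. r z < 0} \<and> frontier \<Omega> = {z\<in>U. r z = 0} \<and>
     (\<forall>a\<in>frontier \<Omega>. r differentiable (at a) \<and> frechet_derivative r (at a) \<noteq> (\<lambda>v. 0))"

definition smoothly_bounded :: "(complex ^ 'n) set \<Rightarrow> bool" where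
  "smoothly_bounded \<Omega> \<longleftrightarrow>
     bounded \<Omega> \<and> (\<exists>U r. defining_function \<Omega> U r \<and> (\<forall>k. Ck_on k U r))"

section \<open>Strong linear convexity\<close>

definition complex_hyperplane :: "(complex ^ 'n) set \<Rightarrow> bool" where
  "complex_hyperplane H \<longleftrightarrow> (\<exists>c b. c \<noteq> 0 \<and> H = {z. (\<Sum>j\<in>UNIV. c $ j * z $ j) = b})"

definition linearly_convex :: "(complex ^ 'n) set \<Rightarrow> bool" where
  "linearly_convex \<Omega> \<longleftrightarrow> (\<forall>p. p \<notin> \<Omega> \<longrightarrow> (\<exists>H. complex_hyperplane H \<and> p \<in> H \<and> H \<inter> \<Omega> = {}))"

text \<open>The Wirtinger derivatives \<open>\<partial>/\<partial>z\<^sub>j = (\<partial>/\<partial>x\<^sub>j - i \<partial>/\<partial>y\<^sub>j) / 2\<close> and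
  \<open>\<partial>/\<partial>\<bar>z\<^sub>j = (\<partial>/\<partial>x\<^sub>j + i \<partial>/\<partial>y\<^sub>j) / 2\<close>.\<close>

definition wirtinger :: "'n \<Rightarrow> (complex ^ 'n \<Rightarrow> complex) \<Rightarrow> complex ^ 'n \<Rightarrow> complex" where
  "wirtinger j g a = (frechet_derivative g (at a) (axis j 1)
                      - \<i> * frechet_derivative g (at a) (axis j \<i>)) / 2"

definition wirtinger_bar :: "'n \<Rightarrow> (complex ^ 'n \<Rightarrow> complex) \<Rightarrow> complex ^ 'n \<Rightarrow> complex" where
  "wirtinger_bar j g a = (frechet_derivative g (at a) (axis j 1)
                          + \<i> * frechet_derivative g (at a) (axis j \<i>)) / 2"

text \<open>The Levi form is real for \<open>r\<close> of class \<open>C^2\<close>, so taking its real part is harmless.  The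
  condition does not depend on the choice of the defining function.\<close>

definition strongly_linearly_convex :: "(complex ^ 'n) set \<Rightarrow> bool" where
  "strongly_linearly_convex \<Omega> \<longleftrightarrow> bounded_domain \<Omega> \<and> linearly_convex \<Omega> \<and>
     (\<exists>U r. defining_function \<Omega> U r \<and> Ck_on 2 U r \<and>
       (let \<rho> = (\<lambda>z. complex_of_real (r z)) in
        \<forall>a\<in>frontier \<Omega>. \<forall>X. X \<noteq> 0 \<longrightarrow> (\<Sum>j\<in>UNIV. wirtinger j \<rho> a * X $ j) = 0 \<longrightarrow>
          Re (\<Sum>j\<in>UNIV. \<Sum>k\<in>UNIV.
                wirtinger j (wirtinger_bar k \<rho>) a * X $ j * cnj (X $ k))
          > cmod (\<Sum>j\<in>UNIV. \<Sum>k\<in>UNIV.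
                wirtinger j (wirtinger k \<rho>) a * X $ j * X $ k)))"

end

theory Submission
  imports Defs "HOL-Complex_Analysis.Riemann_Mapping"
begin

text \<open>Both cases are reduced to Goldilocks domains.  If \<open>\<phi>\<close> is a geodesic of a Goldilocks domain, the
  logarithmic upper bound for the Kobayashi distance forces
  \<open>\<delta>(\<phi>(z)) \<le> C (1 - |z|)^\<beta>\<close>, while the infinitesimal metric gives
  \<open>(1 - |z|) |\<phi>'(z)| \<le> M(\<delta>(\<phi>(z)))\<close>.  Summed over the dyadic annuli \<open>1 - |z| \<approx> 2^-k\<close>, the right-hand
  side is comparable with \<open>\<integral> M(r)/r dr\<close>, so the dilations \<open>\<phi>((1 - 2^-k) z)\<close> converge uniformly on the
  closed disc.

  For a strongly linearly convex domain and a boundary point \<open>a\<close>, the equation \<open>L\<close> of the complex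
  tangent hyperplane has no zeros in the domain and satisfies \<open>|L(z - a)| \<ge> c |z - a|^2\<close> near \<open>a\<close>.  If \<open>f\<close>
  is a disc with \<open>a\<close> the boundary point nearest to \<open>f(0)\<close>, Harnack's inequality applied to
  \<open>- log |L(f - a)|\<close> yields \<open>|L(f - a)| \<le> C \<delta>^(1/2)\<close> on a smaller disc.  Hence \<open>|f - a| \<le> C \<delta>^(1/4)\<close> there,
  and Cauchy's estimate gives \<open>M(r) \<le> C r^(1/4)\<close>.  The logarithmic bound for the distance follows
  from interior balls of a fixed radius.\<close>

section \<open>Complex geodesics of Goldilocks domains\<close>

lemma ennreal_inverse_antimono:
  fixes x y :: ennreal
  shows "x \<le> y \<Longrightarrow> inverse y \<le> inverse x"
  including ennreal.lifting by transfer (rule ereal_inverse_antimono)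

text \<open>A condensation argument: on the interval from \<open>s * q ^ Suc k\<close> to
  \<open>s * q ^ k\<close> monotonicity bounds the integrand below by
  \<open>M (s * q ^ Suc k) / (s * q ^ k)\<close>, and the length is
  \<open>(1 - q) * (s * q ^ k)\<close>. Each interval therefore contributes at least
  \<open>1 - q\<close> times a term of the series.\<close>

lemma geometric_series_finite_of_integral:
  fixes M :: "real \<Rightarrow> ennreal"
  assumes M: "mono M" and q: "0 < q" "q < 1" and s: "0 < s" "s < \<epsilon>"
    and fin: "(\<integral>\<^sup>+r\<in>{0<..<\<epsilon>}. (1 / ennreal r * M r) \<partial>lborel) < \<infinity>"
  shows "(\<Sum>k. M (s * q ^ Suc k)) < \<infinity>"
proof -
  define I where "I k = {s * q ^ Suc k <.. s * q ^ k}" for k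
  \<comment> \<open>Each factor takes its smallest value on \<open>I k\<close>: \<open>M\<close> at
    the left end, \<open>1 / r\<close> at the right end. The half-open intervals are disjoint, so at
    every \<open>r\<close> at most one summand is nonzero.\<close>
  define f where "f k r = M (s * q ^ Suc k) * (1 / ennreal (s * q ^ k)) * indicator (I k) r" for k r
  define F where "F r = 1 / ennreal r * M r * indicator {0<..<\<epsilon>} r" for r :: real
  have fF: "f k r \<le> F r" for k r
  proof (cases "r \<in> I k")
    case True
    have "0 < s * q ^ Suc k" using s q by simp
    moreover have "s * q ^ k \<le> s" using s q by (simp add: mult_le_cancel_left1 power_le_one)
    ultimately have r: "0 < r" "r < \<epsilon>" "s * q ^ Suc k \<le> r" "r \<le> s * q ^ k"
      using True s(2) unfolding I_def by auto
    have "1 / ennreal (s * q ^ k) \<le> 1 / ennreal r"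
      using r unfolding divide_ennreal_def
      by (intro mult_left_mono) (auto simp: ennreal_inverse_antimono)
    moreover have "M (s * q ^ Suc k) \<le> M r" using r M by (simp add: monoD)
    ultimately show ?thesis using True r
      by (auto simp: f_def F_def mult.commute intro!: mult_mono)
  qed (simp add: f_def)
  have disj: "r \<notin> I j" if "r \<in> I k" "k \<noteq> j" for r k j
  proof -
    have less: False if "r \<in> I a" "r \<in> I b" "a < b" for a b
    proof -
      have "q ^ b \<le> q ^ Suc a" using that q by (intro power_decreasing) auto
      then have "s * q ^ b \<le> s * q ^ Suc a" using s by (intro mult_left_mono) auto
      with that show False by (auto simp: I_def)
    qed
    show ?thesis using less[of k j] less[of j k] that by (cases "k < j") auto
  qed
  have sF: "(\<Sum>k. f k r) \<le> F r" for r
  proof (cases "\<exists>k. r \<in> I k")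
    case True
    then obtain k where k: "r \<in> I k" by blast
    have "(\<Sum>j. f j r) = (\<Sum>j\<in>{k}. f j r)"
      by (rule suminf_finite) (use disj[OF k] in \<open>auto simp: f_def\<close>)
    with fF[of k r] show ?thesis by simp
  qed (simp add: f_def)
  have int: "(\<integral>\<^sup>+r. f k r \<partial>lborel) = ennreal (1 - q) * M (s * q ^ Suc k)" for k
  proof -
    have "emeasure lborel (I k) = ennreal (s * q ^ k - s * q ^ Suc k)"
      unfolding I_def using s q by (subst emeasure_lborel_Ioc) (auto simp: mult_le_cancel_right1)
    then have "(\<integral>\<^sup>+r. f k r \<partial>lborel)
        = M (s * q ^ Suc k) * (1 / ennreal (s * q ^ k)) * ennreal (s * q ^ k - s * q ^ Suc k)"
      unfolding f_def by (subst nn_integral_cmult_indicator) (auto simp: I_def)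
    also have "1 / ennreal (s * q ^ k) = ennreal (1 / (s * q ^ k))"
      using s q by (metis divide_ennreal ennreal_1 mult_pos_pos zero_le_one zero_less_power)
    also have "M (s * q ^ Suc k) * ennreal (1 / (s * q ^ k)) * ennreal (s * q ^ k - s * q ^ Suc k)
        = M (s * q ^ Suc k) * ennreal (1 / (s * q ^ k) * (s * q ^ k - s * q ^ Suc k))"
      using s q by (subst ennreal_mult'') (auto simp: mult.assoc mult_le_cancel_right1)
    also have "1 / (s * q ^ k) * (s * q ^ k - s * q ^ Suc k) = 1 - q"
      using s q by (simp add: field_simps)
    finally show ?thesis by (simp add: mult.commute)
  qed
  have "ennreal (1 - q) * (\<Sum>k. M (s * q ^ Suc k)) = (\<Sum>k. \<integral>\<^sup>+r. f k r \<partial>lborel)"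
    using int by simp
  also have "\<dots> = (\<integral>\<^sup>+r. (\<Sum>k. f k r) \<partial>lborel)"
    by (rule nn_integral_suminf[symmetric]) (simp add: f_def I_def)
  also have "\<dots> \<le> (\<integral>\<^sup>+r. F r \<partial>lborel)"
    by (intro nn_integral_mono sF)
  also have "\<dots> < \<infinity>" using fin by (simp add: F_def)
  finally show ?thesis
    using q by (auto simp: ennreal_mult_less_top ennreal_mult_eq_top_iff top.not_eq_extremum)
qed

text \<open>\<open>B k\<close> controls the derivative times the width of the k-th dyadic annulus,
  hence the increment of \<open>g\<close> across that annulus along a radius. The dilations
  \<open>G k\<close> are continuous on the closed disc, and their increments are dominated by the
  summable \<open>B\<close>.\<close>

lemma holomorphic_extends_continuously:
  fixes g :: "complex \<Rightarrow> complex"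
  assumes g: "g holomorphic_on ball 0 1"
    and B: "summable B"
    and bd: "\<And>k w. 1 - (1/2) ^ k \<le> cmod w \<Longrightarrow> cmod w \<le> 1 - (1/2) ^ Suc k \<Longrightarrow>
               (1/2) ^ Suc k * cmod (deriv g w) \<le> B k"
  shows "\<exists>\<psi>. continuous_on (cball 0 1) \<psi> \<and> (\<forall>z\<in>ball 0 1. \<psi> z = g z)"
proof -
  define t :: "nat \<Rightarrow> real" where "t k = 1 - (1/2) ^ k" for k
  define G where "G k z = g (of_real (t k) * z)" for k z
  have t: "0 \<le> t k" "t k < 1" "t k \<le> t (Suc k)" "t (Suc k) - t k = (1/2) ^ Suc k" for k
    by (auto simp: t_def power_le_one)
  have in_ball: "of_real (t k) * z \<in> ball 0 1" if "z \<in> cball 0 1" for k and z :: complex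
  proof -
    have "t k * cmod z \<le> t k * 1" using that t by (intro mult_left_mono) auto
    then show ?thesis using t(1,2)[of k] by (auto simp: norm_mult)
  qed
  have contG: "continuous_on (cball 0 1) (G k)" for k
    unfolding G_def
    by (rule continuous_on_compose2[OF holomorphic_on_imp_continuous_on[OF g]])
       (auto intro!: continuous_intros simp del: mem_ball_0 dest: in_ball)
  have holG: "G k holomorphic_on ball 0 1" for k
    unfolding G_def
    by (rule holomorphic_on_compose_gen[OF _ g, unfolded o_def])
       (use in_ball in \<open>auto intro!: holomorphic_intros\<close>)
  \<comment> \<open>The maximum principle reduces the estimate to \<open>cmod z = 1\<close>. Only
    there does the segment from \<open>t k * z\<close> to \<open>t (Suc k) * z\<close> lie exactly
    across the k-th annulus, where the derivative bound for index \<open>k\<close> applies.\<close>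
  have step: "cmod (G (Suc k) z - G k z) \<le> B k" if "z \<in> cball 0 1" for k z
  proof (rule maximum_modulus_frontier[of "\<lambda>z. G (Suc k) z - G k z" "cball 0 1"])
    show "(\<lambda>z. G (Suc k) z - G k z) holomorphic_on interior (cball 0 1)"
      using holG by (auto intro!: holomorphic_intros)
    show "continuous_on (closure (cball 0 1)) (\<lambda>z. G (Suc k) z - G k z)"
      using contG by (auto intro!: continuous_intros)
    fix z :: complex assume "z \<in> frontier (cball 0 1)"
    then have z: "cmod z = 1" by simp
    define S where "S = closed_segment (of_real (t k) * z) (of_real (t (Suc k)) * z)"
    have S: "\<exists>u. w = of_real u * z \<and> t k \<le> u \<and> u \<le> t (Suc k)" if "w \<in> S" for w
    proof -
      obtain v where v: "0 \<le> v" "v \<le> 1"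
        "w = (1 - v) *\<^sub>R (of_real (t k) * z) + v *\<^sub>R (of_real (t (Suc k)) * z)"
        using \<open>w \<in> S\<close> unfolding S_def closed_segment_def mem_Collect_eq by blast
      let ?u = "(1 - v) * t k + v * t (Suc k)"
      have "v * t k \<le> v * t (Suc k)" "(1 - v) * t k \<le> (1 - v) * t (Suc k)"
        using v t by (auto intro!: mult_left_mono)
      then have "t k \<le> ?u" "?u \<le> t (Suc k)" by (auto simp: algebra_simps)
      moreover have "w = of_real ?u * z" using v by (simp add: scaleR_conv_of_real algebra_simps)
      ultimately show ?thesis by blast
    qed
    have "cmod (g (of_real (t (Suc k)) * z) - g (of_real (t k) * z))
        \<le> (B k / (1/2) ^ Suc k) * cmod (of_real (t (Suc k)) * z - of_real (t k) * z)"
    proof (rule field_differentiable_bound[of S])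
      show "convex S" by (simp add: S_def)
      show "of_real (t (Suc k)) * z \<in> S" "of_real (t k) * z \<in> S" by (auto simp: S_def)
      fix w assume "w \<in> S"
      then obtain u where u: "w = of_real u * z" "t k \<le> u" "u \<le> t (Suc k)" using S by blast
      then have cw: "cmod w = u" using z t[of k] by (simp add: norm_mult)
      then have "w \<in> ball 0 1" using u t(2)[of "Suc k"] by simp
      then show "(g has_field_derivative deriv g w) (at w within S)"
        using holomorphic_derivI[OF g] by auto
      have "(1/2) ^ Suc k * cmod (deriv g w) \<le> B k"
        using bd[of k w] u cw unfolding t_def by simp
      then show "cmod (deriv g w) \<le> B k / (1/2) ^ Suc k" by (simp add: field_simps)
    qed
    also have "of_real (t (Suc k)) * z - of_real (t k) * z = of_real ((1/2) ^ Suc k) * z"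
      unfolding t(4)[symmetric] by (simp add: algebra_simps)
    also have "(B k / (1/2) ^ Suc k) * cmod (of_real ((1/2) ^ Suc k) * z) = B k"
      using z by (simp add: norm_mult norm_power del: power_Suc)
    finally show "cmod (G (Suc k) z - G k z) \<le> B k" unfolding G_def .
  qed (use that in auto)
  have "uniformly_convergent_on (cball 0 1) (\<lambda>n z. \<Sum>k<n. G (Suc k) z - G k z)"
    by (rule Weierstrass_m_test'[OF _ B]) (rule step)
  then obtain L where L: "uniform_limit (cball 0 1) (\<lambda>n z. \<Sum>k<n. G (Suc k) z - G k z) L sequentially"
    by (auto simp: uniformly_convergent_on_def)
  have sum: "(\<Sum>k<n. G (Suc k) z - G k z) = G n z - G 0 z" for n z
    by (rule sum_lessThan_telescope)
  \<comment> \<open>The telescoped limit misses the initial term \<open>G 0\<close>, which is the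
    constant \<open>g 0\<close> because \<open>t 0 = 0\<close>.\<close>
  define \<psi> where "\<psi> z = L z + G 0 z" for z
  have contL: "continuous_on (cball 0 1) L"
    by (rule uniform_limit_theorem[OF _ L]) (auto intro!: always_eventually continuous_intros contG simp: sum)
  have "\<psi> z = g z" if z: "z \<in> ball 0 1" for z
  proof -
    have "(\<lambda>n. G n z - G 0 z) \<longlonglongrightarrow> L z"
      using tendsto_uniform_limitI[OF L, of z] z by (simp add: sum)
    then have 1: "(\<lambda>n. G n z) \<longlonglongrightarrow> \<psi> z" unfolding \<psi>_def
      using tendsto_add[of "\<lambda>n. G n z - G 0 z" "L z" sequentially "\<lambda>_. G 0 z" "G 0 z"] by simp
    have "(\<lambda>n. (1/2::real) ^ n) \<longlonglongrightarrow> 0" by (intro LIMSEQ_power_zero) auto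
    then have "(\<lambda>n. of_real (t n) * z) \<longlonglongrightarrow> of_real (1 - 0) * z"
      unfolding t_def by (intro tendsto_mult tendsto_of_real tendsto_diff tendsto_const)
    then have "(\<lambda>n. of_real (t n) * z) \<longlonglongrightarrow> z" by simp
    moreover have "isCont g z"
      using g z holomorphic_on_imp_continuous_on continuous_on_eq_continuous_at open_ball by blast
    ultimately have "(\<lambda>n. G n z) \<longlonglongrightarrow> g z"
      unfolding G_def using isCont_tendsto_compose by blast
    with 1 show ?thesis using LIMSEQ_unique by blast
  qed
  moreover have "continuous_on (cball 0 1) \<psi>"
    unfolding \<psi>_def by (intro continuous_intros contL contG)
  ultimately show ?thesis by blast
qed

section \<open>Derivatives of holomorphic discs and the infinitesimal metric\<close>

lemma kobayashi_metric_le: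
  assumes "holomorphic_disc \<Omega> f" "f 0 = x" "\<And>i. deriv (\<lambda>z. f z $ i) 0 * \<xi> = v $ i"
  shows "kobayashi_metric \<Omega> x v \<le> cmod \<xi>"
  unfolding kobayashi_metric_def
  by (rule cInf_lower) (use assms in \<open>auto intro!: bdd_belowI[where m = 0]\<close>)

text \<open>Recentring: the automorphism of the unit disc that takes 0 to \<open>z\<close> has
  derivative \<open>1 - |z|^2\<close> at 0, which produces the factor in the chain rule. Estimates
  at the centre of a disc thus become estimates at any of its points.\<close>

lemma holomorphic_disc_moebius:
  assumes f: "holomorphic_disc \<Omega> f" and z: "z \<in> ball 0 1"
  obtains h where "holomorphic_disc \<Omega> h" "h 0 = f z"
    "\<And>i. deriv (\<lambda>w. h w $ i) 0 = of_real (1 - (cmod z)\<^sup>2) * deriv (\<lambda>w. f w $ i) z"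
proof
  define m where "m = Moebius_function 0 (- z)"
  have z': "cmod (- z) < 1" using z by simp
  have m: "m holomorphic_on ball 0 1" "m ` ball 0 1 \<subseteq> ball 0 1"
    unfolding m_def using Moebius_function_holomorphic[OF z'] Moebius_function_norm_lt_1[OF z'] by auto
  have m0: "m 0 = z" by (simp add: m_def Moebius_function_of_zero)
  have m_eq: "m = (\<lambda>w. (w + z) / (1 + cnj z * w))"
    by (auto simp: m_def Moebius_function_simple fun_eq_iff)
  have dm: "(m has_field_derivative of_real (1 - (cmod z)\<^sup>2)) (at 0)"
    unfolding m_eq by (auto intro!: derivative_eq_intros simp: complex_norm_square mult.commute simp flip: of_real_power)
  show "holomorphic_disc \<Omega> (f \<circ> m)"
    unfolding holomorphic_disc_def
  proof (intro conjI allI)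
    fix i
    have "(\<lambda>z. f z $ i) holomorphic_on ball 0 1" using f by (simp add: holomorphic_disc_def)
    from holomorphic_on_compose_gen[OF m(1) this m(2)]
    show "(\<lambda>z. (f \<circ> m) z $ i) holomorphic_on ball 0 1" by (simp add: o_def)
    show "(f \<circ> m) ` ball 0 1 \<subseteq> \<Omega>" using m(2) f by (auto simp: holomorphic_disc_def)
  qed
  show "(f \<circ> m) 0 = f z" by (simp add: m0)
  fix i
  have "(\<lambda>z. f z $ i) holomorphic_on ball 0 1" using f by (simp add: holomorphic_disc_def)
  then have "((\<lambda>z. f z $ i) has_field_derivative deriv (\<lambda>w. f w $ i) z) (at (m 0))"
    using holomorphic_derivI[OF _ open_ball z] m0 by auto
  from DERIV_chain2[OF this dm]
  show "deriv (\<lambda>w. (f \<circ> m) w $ i) 0 = of_real (1 - (cmod z)\<^sup>2) * deriv (\<lambda>w. f w $ i) z"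
    by (simp add: DERIV_imp_deriv mult.commute)
qed

lemma mono_M_Omega: "mono (M_Omega \<Omega>)"
  unfolding M_Omega_def by (intro monoI Sup_subset_mono) (blast intro: order_trans)

text \<open>The recentred disc competes in the definition of the metric at \<open>f z\<close>. In
  the direction of its normalised derivative \<open>u\<close> it gives a metric of at most
  \<open>1 / norm u\<close>, so \<open>norm u\<close>, and with it every coordinate, is bounded by
  \<open>M_Omega\<close>.\<close>

lemma holomorphic_disc_deriv_le_M_Omega:
  assumes f: "holomorphic_disc \<Omega> f" and z: "z \<in> ball 0 1"
    and r: "boundary_dist \<Omega> (f z) \<le> r"
  shows "ennreal ((1 - (cmod z)\<^sup>2) * cmod (deriv (\<lambda>w. f w $ i) z)) \<le> M_Omega \<Omega> r"
proof -
  obtain h where h: "holomorphic_disc \<Omega> h" "h 0 = f z"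
    "\<And>i. deriv (\<lambda>w. h w $ i) 0 = of_real (1 - (cmod z)\<^sup>2) * deriv (\<lambda>w. f w $ i) z"
    using holomorphic_disc_moebius[OF f z] by blast
  have z1: "0 < 1 - (cmod z)\<^sup>2" using z by (simp add: abs_square_less_1)
  define u where "u = (\<chi> i. deriv (\<lambda>w. h w $ i) 0)"
  show ?thesis
  proof (cases "u = 0")
    case True
    then have "deriv (\<lambda>w. h w $ i) 0 = 0" by (simp add: u_def vec_eq_iff)
    moreover have "complex_of_real (1 - (cmod z)\<^sup>2) \<noteq> 0" using z1 of_real_eq_0_iff by (metis less_irrefl)
    ultimately have "deriv (\<lambda>w. f w $ i) z = 0" using h(3)[of i] by simp
    then show ?thesis by simp
  next
    case False
    define v where "v = (1 / norm u) *\<^sub>R u"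
    have v: "norm v = 1" using False by (simp add: v_def)
    have vi: "v $ i = u $ i * of_real (1 / norm u)" for i
      by (simp add: v_def) (simp add: scaleR_conv_of_real divide_simps)
    have "kobayashi_metric \<Omega> (f z) v \<le> cmod (of_real (1 / norm u))"
      by (rule kobayashi_metric_le[OF h(1,2)])
         (use vi in \<open>simp add: u_def\<close>)
    then have k: "kobayashi_metric \<Omega> (f z) v \<le> 1 / norm u" by (simp add: norm_divide)
    have "(1 - (cmod z)\<^sup>2) * cmod (deriv (\<lambda>w. f w $ i) z) = cmod (u $ i)"
      using z1 abs_of_pos[OF z1] by (simp only: u_def vec_lambda_beta h(3) norm_mult norm_of_real)
    also have "\<dots> \<le> norm u" by (rule Finite_Cartesian_Product.norm_nth_le)
    finally have "ennreal ((1 - (cmod z)\<^sup>2) * cmod (deriv (\<lambda>w. f w $ i) z)) \<le> ennreal (norm u)"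
      by (rule ennreal_leI)
    also have "\<dots> = 1 / ennreal (1 / norm u)"
      using False by (simp add: divide_ennreal flip: ennreal_1)
    also have "\<dots> \<le> 1 / ennreal (kobayashi_metric \<Omega> (f z) v)"
      using k by (auto simp: divide_ennreal_def intro!: ennreal_inverse_antimono ennreal_leI)
    also have "\<dots> \<le> M_Omega \<Omega> r"
    proof -
      have "f z \<in> \<Omega>" using f z unfolding holomorphic_disc_def by blast
      then show ?thesis unfolding M_Omega_def using r v by (intro Sup_upper) blast
    qed
    finally show ?thesis .
  qed
qed

section \<open>Boundary distance along geodesics and the extension theorem\<close>

lemma frontier_bounded_domain:
  fixes \<Omega> :: "(complex ^ 'n) set"
  assumes "bounded_domain \<Omega>"
  shows "compact (frontier \<Omega>)" "frontier \<Omega> \<noteq> {}" "open \<Omega>" "\<Omega> \<inter> frontier \<Omega> = {}"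
proof -
  have b: "bounded \<Omega>" "open \<Omega>" "\<Omega> \<noteq> {}" using assms by (auto simp: bounded_domain_def)
  show "compact (frontier \<Omega>)" using b by (intro compact_frontier_bounded)
  have "\<Omega> \<noteq> UNIV" using b(1) not_bounded_UNIV by blast
  then show "frontier \<Omega> \<noteq> {}" using b by (intro frontier_not_empty) auto
  show "open \<Omega>" "\<Omega> \<inter> frontier \<Omega> = {}" using b by (auto simp: frontier_def interior_open)
qed

lemma boundary_dist_pos:
  assumes "bounded_domain \<Omega>" "x \<in> \<Omega>"
  shows "0 < boundary_dist \<Omega> x"
  unfolding boundary_dist_def
  using frontier_bounded_domain[OF assms(1)] assms(2)
  by (metis compact_imp_closed disjoint_iff infdist_nonneg in_closed_iff_infdist_zero less_eq_real_def)

text \<open>Along a geodesic the distance from \<open>\<phi> 0\<close> equals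
  \<open>artanh (cmod z)\<close>, which grows at least like half the logarithm of
  \<open>1 / (1 - cmod z)\<close>. Comparison with the logarithmic upper bound gives a power of
  \<open>1 - cmod z\<close> after exponentiation.\<close>

lemma geodesic_boundary_dist:
  assumes \<Omega>: "goldilocks \<Omega>" and \<phi>: "complex_geodesic \<Omega> \<phi>"
  obtains C \<beta> where "C > 0" "\<beta> > 0"
    "\<And>z. z \<in> ball 0 1 \<Longrightarrow> boundary_dist \<Omega> (\<phi> z) \<le> C * (1 - cmod z) powr \<beta>"
proof -
  have dom: "bounded_domain \<Omega>" using \<Omega> by (simp add: goldilocks_def)
  have in\<Omega>: "\<phi> z \<in> \<Omega>" if "z \<in> ball 0 1" for z
    using \<phi> that by (auto simp: complex_geodesic_def holomorphic_disc_def)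
  have "\<phi> 0 \<in> \<Omega>" by (simp add: in\<Omega>)
  then obtain C \<alpha> where C: "C > 0" "\<alpha> > 0"
    "\<And>x. x \<in> \<Omega> \<Longrightarrow> kobayashi_dist \<Omega> (\<phi> 0) x \<le> C + \<alpha> * ln (1 / boundary_dist \<Omega> x)"
    using \<Omega> unfolding goldilocks_def by metis
  show thesis
  proof
    \<comment> \<open>Both witnesses are read off by dividing
      \<open>\<alpha> * ln ?d \<le> C + ln (1 - cmod z) / 2\<close> by \<open>\<alpha>\<close> and
      exponentiating.\<close>
    show "exp (C / \<alpha>) > 0" "1 / (2 * \<alpha>) > 0" using C by auto
    fix z :: complex assume z: "z \<in> ball 0 1"
    let ?d = "boundary_dist \<Omega> (\<phi> z)"
    have d: "0 < ?d" using boundary_dist_pos[OF dom in\<Omega>[OF z]] .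
    have z1: "cmod z < 1" using z by simp
    have "ln (1 / (1 - cmod z)) / 2 \<le> artanh (cmod z)"
      unfolding artanh_def using z1 by (intro divide_right_mono ln_mono) (auto simp: divide_right_mono)
    also have "\<dots> = poincare_dist 0 z" by (simp add: poincare_dist_def)
    also have "\<dots> = kobayashi_dist \<Omega> (\<phi> 0) (\<phi> z)"
      using \<phi> z by (simp add: complex_geodesic_def)
    also have "\<dots> \<le> C + \<alpha> * ln (1 / ?d)" using C(3)[OF in\<Omega>[OF z]] .
    finally have "\<alpha> * ln ?d \<le> C + ln (1 - cmod z) / 2"
      using d z1 by (simp add: ln_div)
    then have "ln ?d \<le> C / \<alpha> + ln (1 - cmod z) * (1 / (2 * \<alpha>))"
      using C by (simp add: field_simps)
    then have "exp (ln ?d) \<le> exp (C / \<alpha> + ln (1 - cmod z) * (1 / (2 * \<alpha>)))" by simp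
    then show "?d \<le> exp (C / \<alpha>) * (1 - cmod z) powr (1 / (2 * \<alpha>))"
      using d z1 by (simp add: exp_add powr_def mult.commute)
  qed
qed

text \<open>In the k-th dyadic annulus the boundary distance is at most \<open>C * q ^ k\<close>, so
  the derivative bound there is \<open>M_Omega \<Omega> (C * q ^ k)\<close>. The integral condition
  makes these bounds summable, and each coordinate is extended separately.\<close>

theorem goldilocks_geodesic_extends:
  fixes \<Omega> :: "(complex ^ 'n) set"
  assumes \<Omega>: "goldilocks \<Omega>" and \<phi>: "complex_geodesic \<Omega> \<phi>"
  shows "\<exists>\<psi>. continuous_on (cball 0 1) \<psi> \<and> \<psi> ` cball 0 1 \<subseteq> closure \<Omega> \<and>
             (\<forall>z\<in>ball 0 1. \<psi> z = \<phi> z)"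
proof -
  have disc: "holomorphic_disc \<Omega> \<phi>" using \<phi> by (simp add: complex_geodesic_def)
  obtain C \<beta> where C: "C > 0" "\<beta> > 0"
    "\<And>z. z \<in> ball 0 1 \<Longrightarrow> boundary_dist \<Omega> (\<phi> z) \<le> C * (1 - cmod z) powr \<beta>"
    using geodesic_boundary_dist[OF \<Omega> \<phi>] by blast
  obtain \<epsilon> where \<epsilon>: "\<epsilon> > 0" "(\<integral>\<^sup>+r\<in>{0<..<\<epsilon>}. (1 / ennreal r * M_Omega \<Omega> r) \<partial>lborel) < \<infinity>"
    using \<Omega> by (auto simp: goldilocks_def)
  \<comment> \<open>The ratio for which \<open>((1/2) ^ k) powr \<beta>\<close> equals
    \<open>q ^ k\<close>.\<close>
  define q where "q = (1/2) powr \<beta>"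
  have q: "0 < q" "q < 1" using C(2) powr_less_mono2[of \<beta> "1/2" 1] by (simp_all add: q_def)
  \<comment> \<open>The starting radius of the geometric series has to lie inside the interval on
    which the integral is finite, so the first terms are skipped.\<close>
  obtain n where n: "C * q ^ n < \<epsilon>"
  proof -
    have "(\<lambda>n. C * q ^ n) \<longlonglongrightarrow> C * 0" using q by (intro tendsto_intros LIMSEQ_power_zero) auto
    then have "eventually (\<lambda>n. C * q ^ n < \<epsilon>) sequentially" using \<epsilon>(1) by (intro order_tendstoD) auto
    then show thesis using that by (auto simp: eventually_sequentially)
  qed
  have "(\<Sum>k. M_Omega \<Omega> (C * q ^ n * q ^ Suc k)) < \<infinity>"
    by (rule geometric_series_finite_of_integral[OF mono_M_Omega q _ n \<epsilon>(2)]) (use C q in auto)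
  also have "(\<lambda>k. C * q ^ n * q ^ Suc k) = (\<lambda>k. C * q ^ (k + Suc n))"
    by (simp add: power_add mult_ac)
  finally have fin: "(\<Sum>k. M_Omega \<Omega> (C * q ^ (k + Suc n))) < \<infinity>" .
  have fin1: "M_Omega \<Omega> (C * q ^ k) < \<infinity>" if "k \<ge> Suc n" for k
    using ennreal_suminf_lessD[OF fin, of "k - Suc n"] that by simp
  \<comment> \<open>\<open>enn2real\<close> sends infinity to 0, so these reals represent
    \<open>M_Omega\<close> only where it is finite, in particular for \<open>k \<ge> Suc n\<close>;
    summability depends on that tail alone.\<close>
  have summ: "summable (\<lambda>k. enn2real (M_Omega \<Omega> (C * q ^ k)))"
  proof -
    have "summable (\<lambda>k. enn2real (M_Omega \<Omega> (C * q ^ (k + Suc n))))"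
    proof (rule summable_suminf_not_top)
      have "(\<lambda>k. ennreal (enn2real (M_Omega \<Omega> (C * q ^ (k + Suc n)))))
          = (\<lambda>k. M_Omega \<Omega> (C * q ^ (k + Suc n)))"
        using fin1 by (intro ext ennreal_enn2real) (simp del: power_Suc)
      then show "(\<Sum>k. ennreal (enn2real (M_Omega \<Omega> (C * q ^ (k + Suc n))))) \<noteq> top"
        using fin by simp
    qed simp
    then show ?thesis by (subst (asm) summable_iff_shift)
  qed
  have "\<exists>\<psi>. continuous_on (cball 0 1) \<psi> \<and> (\<forall>z\<in>ball 0 1. \<psi> z = \<phi> z $ i)" for i
  proof -
    let ?g = "\<lambda>z. \<phi> z $ i"
    have g: "?g holomorphic_on ball 0 1" using disc by (simp add: holomorphic_disc_def)
    \<comment> \<open>The finitely many annuli on which \<open>M_Omega\<close> might be infinite are handled by compactness.\<close>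
    have ex: "\<exists>b. \<forall>w. 1 - (1/2) ^ k \<le> cmod w \<longrightarrow> cmod w \<le> 1 - (1/2) ^ Suc k \<longrightarrow>
        (1/2) ^ Suc k * cmod (deriv ?g w) \<le> b" for k
    proof -
      have "cball 0 (1 - (1/2) ^ Suc k) \<subseteq> ball (0 :: complex) 1"
        by (simp add: cball_subset_ball_iff)
      then have "continuous_on (cball 0 (1 - (1/2) ^ Suc k)) (deriv ?g)"
        using holomorphic_on_imp_continuous_on[OF holomorphic_deriv[OF g open_ball]]
        by (rule continuous_on_subset[rotated])
      then have "bounded (deriv ?g ` cball 0 (1 - (1/2) ^ Suc k))"
        by (intro compact_imp_bounded compact_continuous_image) auto
      then obtain b where "\<And>w. w \<in> cball 0 (1 - (1/2) ^ Suc k) \<Longrightarrow> cmod (deriv ?g w) \<le> b"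
        unfolding bounded_iff by blast
      then have "\<forall>w. 1 - (1/2) ^ k \<le> cmod w \<longrightarrow> cmod w \<le> 1 - (1/2) ^ Suc k \<longrightarrow>
        (1/2) ^ Suc k * cmod (deriv ?g w) \<le> (1/2) ^ Suc k * b"
        by (auto intro!: mult_left_mono simp del: power_Suc)
      then show ?thesis by blast
    qed
    then obtain b where b: "\<And>k w. 1 - (1/2) ^ k \<le> cmod w \<Longrightarrow> cmod w \<le> 1 - (1/2) ^ Suc k \<Longrightarrow>
        (1/2) ^ Suc k * cmod (deriv ?g w) \<le> b k" by metis
    \<comment> \<open>For small \<open>k\<close> the value of \<open>enn2real\<close> could be the
      default 0 and bound nothing; the compactness constant \<open>b k\<close> takes its
      place.\<close>
    define B where "B k = (if k \<ge> Suc n then enn2real (M_Omega \<Omega> (C * q ^ k)) else b k)" for k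
    show ?thesis
    proof (rule holomorphic_extends_continuously[OF g])
      have "eventually (\<lambda>k. enn2real (M_Omega \<Omega> (C * q ^ k)) = B k) sequentially"
        unfolding eventually_sequentially by (intro exI[of _ "Suc n"]) (auto simp: B_def)
      with summ show "summable B" using summable_cong by fastforce
    next
      fix k w assume w: "1 - (1/2) ^ k \<le> cmod w" "cmod w \<le> 1 - (1/2) ^ Suc k"
      show "(1/2) ^ Suc k * cmod (deriv ?g w) \<le> B k"
      proof (cases "k \<ge> Suc n")
        case False
        then show ?thesis using b[OF w] by (simp add: B_def)
      next
        case True
        have p: "(0::real) < (1/2) ^ Suc k" by simp
        have w1: "cmod w < 1" using w(2) p by linarith
        have "(1 - cmod w) powr \<beta> \<le> ((1/2) ^ k) powr \<beta>"
          using w w1 C(2) by (intro powr_mono2) auto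
        also have "\<dots> = q ^ k" by (simp add: q_def powr_powr mult.commute flip: powr_realpow)
        finally have "boundary_dist \<Omega> (\<phi> w) \<le> C * q ^ k"
          using C(3)[of w] w1 C(1) by (smt (verit) mem_ball_0 mult_left_mono)
        then have "ennreal ((1 - (cmod w)\<^sup>2) * cmod (deriv ?g w)) \<le> M_Omega \<Omega> (C * q ^ k)"
          using w1 by (intro holomorphic_disc_deriv_le_M_Omega[OF disc]) auto
        then have "enn2real (ennreal ((1 - (cmod w)\<^sup>2) * cmod (deriv ?g w))) \<le> B k"
          using fin1[OF True] True unfolding B_def by (simp add: enn2real_mono del: enn2real_ennreal)
        moreover have "0 \<le> 1 - (cmod w)\<^sup>2" using w1 by (simp add: abs_square_le_1)
        ultimately have *: "(1 - (cmod w)\<^sup>2) * cmod (deriv ?g w) \<le> B k" by simp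
        \<comment> \<open>On the annulus
          \<open>(1/2) ^ Suc k \<le> 1 - cmod w \<le> 1 - (cmod w)\<^sup>2\<close>, which trades the
          conformal factor for the width of the annulus.\<close>
        have "(cmod w)\<^sup>2 \<le> cmod w"
          using w1 by (simp add: power2_eq_square mult_left_le_one_le)
        then have "(1/2) ^ Suc k \<le> 1 - (cmod w)\<^sup>2" using w(2) by linarith
        then have "(1/2) ^ Suc k * cmod (deriv ?g w) \<le> (1 - (cmod w)\<^sup>2) * cmod (deriv ?g w)"
          by (rule mult_right_mono) simp
        with * show ?thesis by linarith
      qed
    qed
  qed
  then obtain \<psi> where \<psi>: "\<And>i. continuous_on (cball 0 1) (\<psi> i)" "\<And>i z. z \<in> ball 0 1 \<Longrightarrow> \<psi> i z = \<phi> z $ i"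
    by metis
  define \<Psi> where "\<Psi> z = (\<chi> i. \<psi> i z)" for z
  have c: "continuous_on (cball 0 1) \<Psi>" unfolding \<Psi>_def by (intro continuous_intros \<psi>)
  have eq: "\<Psi> z = \<phi> z" if "z \<in> ball 0 1" for z using \<psi>(2)[OF that] by (simp add: \<Psi>_def vec_eq_iff)
  have "\<Psi> ` ball 0 1 \<subseteq> \<Omega>" using eq disc by (auto simp: holomorphic_disc_def)
  then have "\<Psi> ` ball 0 1 \<subseteq> closure \<Omega>" using closure_subset by blast
  then have "\<Psi> ` closure (ball 0 1) \<subseteq> closure \<Omega>"
    using c by (intro image_closure_subset) auto
  then have "\<Psi> ` cball 0 1 \<subseteq> closure \<Omega>" by simp
  with c eq show ?thesis by blast
qed

section \<open>Upper bounds for the Kobayashi distance\<close>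

text \<open>Membership of \<open>c\<close> in the set whose infimum is
  \<open>kobayashi_dist\<close>, isolated so that chains can be lengthened one disc at a time and
  upper bounds come from exhibiting a single chain.\<close>

definition kobayashi_chain ::
  "(complex ^ 'n) set \<Rightarrow> complex ^ 'n \<Rightarrow> complex ^ 'n \<Rightarrow> real \<Rightarrow> bool" where
  "kobayashi_chain \<Omega> x y c \<longleftrightarrow>
     (\<exists>n p f a b. c = (\<Sum>j<n. poincare_dist (a j) (b j)) \<and> p 0 = x \<and> p n = y \<and>
        (\<forall>j<n. holomorphic_disc \<Omega> (f j) \<and> a j \<in> ball 0 1 \<and> b j \<in> ball 0 1 \<and>
               f j (a j) = p j \<and> f j (b j) = p (Suc j)))"

lemma poincare_dist_nonneg:
  assumes "z \<in> ball 0 1" "w \<in> ball 0 1"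
  shows "0 \<le> poincare_dist z w"
proof -
  have "cmod ((z - w) / (1 - cnj w * z)) < 1"
    using Moebius_function_norm_lt_1[of w z 0] assms by (simp add: Moebius_function_simple)
  moreover have "0 \<le> artanh t" if "0 \<le> t" "t < 1" for t :: real
    using that by (simp add: artanh_def)
  ultimately show ?thesis by (simp add: poincare_dist_def)
qed

lemma kobayashi_dist_le:
  assumes "kobayashi_chain \<Omega> x y c"
  shows "kobayashi_dist \<Omega> x y \<le> c"
  unfolding kobayashi_dist_def
proof (rule cInf_lower)
  show "bdd_below {(\<Sum>j<n. poincare_dist (a j) (b j)) | n p f a b.
            p 0 = x \<and> p n = y \<and>
            (\<forall>j<n. holomorphic_disc \<Omega> (f j) \<and> a j \<in> ball 0 1 \<and> b j \<in> ball 0 1 \<and>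
                   f j (a j) = p j \<and> f j (b j) = p (Suc j))}"
    by (rule bdd_belowI[where m = 0]) (auto intro!: sum_nonneg poincare_dist_nonneg)
qed (use assms in \<open>unfold kobayashi_chain_def, blast\<close>)

lemma kobayashi_chain_refl: "kobayashi_chain \<Omega> x x 0"
  unfolding kobayashi_chain_def by (rule exI[of _ 0], rule exI[of _ "\<lambda>_. x"]) simp

lemma kobayashi_chain_snoc:
  assumes "kobayashi_chain \<Omega> x y c" and g: "holomorphic_disc \<Omega> g"
    and u: "u \<in> ball 0 1" "v \<in> ball 0 1" "g u = y" "g v = z"
  shows "kobayashi_chain \<Omega> x z (c + poincare_dist u v)"
proof -
  obtain n p f a b where ch: "c = (\<Sum>j<n. poincare_dist (a j) (b j))" "p 0 = x" "p n = y"
    "\<And>j. j < n \<Longrightarrow> holomorphic_disc \<Omega> (f j) \<and> a j \<in> ball 0 1 \<and> b j \<in> ball 0 1 \<and>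
               f j (a j) = p j \<and> f j (b j) = p (Suc j)"
    using assms(1) unfolding kobayashi_chain_def by blast
  let ?p = "p(Suc n := z)" and ?f = "f(n := g)" and ?a = "a(n := u)" and ?b = "b(n := v)"
  have "(\<Sum>j<n. poincare_dist (?a j) (?b j)) = (\<Sum>j<n. poincare_dist (a j) (b j))"
    by (intro sum.cong) auto
  then have "c + poincare_dist u v = (\<Sum>j<Suc n. poincare_dist (?a j) (?b j))"
    by (simp add: ch(1))
  moreover have "?p 0 = x" "?p (Suc n) = z" using ch by auto
  moreover have "\<forall>j<Suc n. holomorphic_disc \<Omega> (?f j) \<and> ?a j \<in> ball 0 1 \<and> ?b j \<in> ball 0 1 \<and>
      ?f j (?a j) = ?p j \<and> ?f j (?b j) = ?p (Suc j)"
    using ch(3) ch(4) g u by (auto simp: less_Suc_eq)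
  ultimately show ?thesis unfolding kobayashi_chain_def by blast
qed

lemma norm_vec_cmult:
  fixes u :: "complex ^ 'n"
  shows "norm (\<chi> i. c * u $ i) = cmod c * norm u"
  by (simp add: norm_vec_def norm_mult L2_set_right_distrib)

lemma holomorphic_disc_affine:
  fixes p u :: "complex ^ 'n"
  assumes "ball p \<rho> \<subseteq> \<Omega>" "norm u \<le> \<rho>" "0 < \<rho>"
  shows "holomorphic_disc \<Omega> (\<lambda>\<zeta>. \<chi> i. p $ i + \<zeta> * u $ i)"
  unfolding holomorphic_disc_def
proof (intro conjI allI)
  show "(\<lambda>\<zeta>. (\<chi> i. p $ i + \<zeta> * u $ i) $ i) holomorphic_on ball 0 1" for i
    by (auto intro!: holomorphic_intros)
  have "(\<chi> i. p $ i + \<zeta> * u $ i) \<in> ball p \<rho>" if "\<zeta> \<in> ball 0 1" for \<zeta>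
  proof -
    have "p - (\<chi> i. p $ i + \<zeta> * u $ i) = - (\<chi> i. \<zeta> * u $ i)" by (simp add: vec_eq_iff)
    then have "dist p (\<chi> i. p $ i + \<zeta> * u $ i) = cmod \<zeta> * norm u"
      unfolding dist_norm by (simp add: norm_vec_cmult)
    also have "\<dots> \<le> cmod \<zeta> * \<rho>" using assms by (intro mult_left_mono) auto
    also have "\<dots> < 1 * \<rho>" using assms that by (intro mult_strict_right_mono) auto
    finally show ?thesis by simp
  qed
  then show "(\<lambda>\<zeta>. \<chi> i. p $ i + \<zeta> * u $ i) ` ball 0 1 \<subseteq> \<Omega>" using assms by blast
qed

text \<open>The affine disc centred at \<open>p\<close> through \<open>q\<close>, with radius
  \<open>\<rho>\<close> when \<open>p\<close> and \<open>q\<close> differ, costs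
  \<open>artanh (dist p q / \<rho>)\<close>. It can be traversed in either direction, towards or
  away from the centre.\<close>

lemma kobayashi_chain_ball:
  fixes p q :: "complex ^ 'n"
  assumes b: "ball p \<rho> \<subseteq> \<Omega>" and q: "dist p q < \<rho>"
  shows "kobayashi_chain \<Omega> x p c \<Longrightarrow> kobayashi_chain \<Omega> x q (c + artanh (dist p q / \<rho>))"
    and "kobayashi_chain \<Omega> x q c \<Longrightarrow> kobayashi_chain \<Omega> x p (c + artanh (dist p q / \<rho>))"
proof -
  have \<rho>: "0 < \<rho>" using q by (smt (verit) zero_le_dist)
  define t where "t = dist p q / \<rho>"
  have t: "0 \<le> t" "t < 1" using q \<rho> by (auto simp: t_def)
  \<comment> \<open>For \<open>p = q\<close> the convention \<open>1 / 0 = 0\<close> gives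
    \<open>u = 0\<close>, and the constant disc still serves.\<close>
  define u where "u = (1 / t) *\<^sub>R (q - p)"
  define g where "g \<zeta> = (\<chi> i. p $ i + \<zeta> * u $ i)" for \<zeta>
  have "norm u \<le> \<rho>"
    using \<rho> by (cases "p = q") (auto simp: u_def t_def dist_norm norm_minus_commute)
  then have disc: "holomorphic_disc \<Omega> g"
    unfolding g_def using holomorphic_disc_affine[OF b] \<rho> by blast
  have g0: "g 0 = p" by (simp add: g_def vec_eq_iff)
  have "t *\<^sub>R u = q - p" using \<rho> by (cases "p = q") (auto simp: u_def t_def)
  then have "complex_of_real t * u $ i = q $ i - p $ i" for i
    by (metis scaleR_conv_of_real vector_minus_component vector_scaleR_component)
  then have gt: "g (of_real t) = q" by (simp add: g_def vec_eq_iff)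
  have tb: "complex_of_real t \<in> ball 0 1" "(0 :: complex) \<in> ball 0 1" using t by auto
  have d: "poincare_dist 0 (of_real t) = artanh (dist p q / \<rho>)"
      "poincare_dist (of_real t) 0 = artanh (dist p q / \<rho>)"
    using t unfolding t_def[symmetric] by (auto simp: poincare_dist_def)
  show "kobayashi_chain \<Omega> x q (c + artanh (dist p q / \<rho>))" if "kobayashi_chain \<Omega> x p c"
    using kobayashi_chain_snoc[OF that disc tb(2) tb(1) g0 gt] by (simp only: d)
  show "kobayashi_chain \<Omega> x p (c + artanh (dist p q / \<rho>))" if "kobayashi_chain \<Omega> x q c"
    using kobayashi_chain_snoc[OF that disc tb(1) tb(2) gt g0] by (simp only: d)
qed

text \<open>Being reachable by a chain is a locally constant property, since two points of a ball
  inside the domain are linked through its centre; connectedness does the rest.\<close>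

lemma kobayashi_chain_exists:
  fixes \<Omega> :: "(complex ^ 'n) set"
  assumes "open \<Omega>" "connected \<Omega>" "x \<in> \<Omega>" "y \<in> \<Omega>"
  shows "\<exists>c. kobayashi_chain \<Omega> x y c"
proof (rule connected_induction_simple[OF assms(2) assms(3) assms(4), where P = "\<lambda>y. \<exists>c. kobayashi_chain \<Omega> x y c"])
  show "\<exists>c. kobayashi_chain \<Omega> x x c" using kobayashi_chain_refl by blast
  fix a assume "a \<in> \<Omega>"
  then obtain d where d: "d > 0" "ball a d \<subseteq> \<Omega>" using assms(1) openE by blast
  have "openin (top_of_set \<Omega>) (ball a d)" using d assms(1) by (simp add: openin_open_eq)
  moreover have "\<exists>c. kobayashi_chain \<Omega> x z c"
    if "y \<in> ball a d" "z \<in> ball a d" "kobayashi_chain \<Omega> x y c" for y z c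
    using kobayashi_chain_ball[OF d(2)] that by (metis mem_ball)
  ultimately show "\<exists>T. openin (top_of_set \<Omega>) T \<and> a \<in> T \<and>
     (\<forall>y\<in>T. \<forall>z\<in>T. (\<exists>c. kobayashi_chain \<Omega> x y c) \<longrightarrow> (\<exists>c. kobayashi_chain \<Omega> x z c))"
    using d(1) by (intro exI[of _ "ball a d"]) auto
qed

text \<open>A finite subcover leaves finitely many centres, each reached by some fixed chain, and
  one more disc of bounded cost reaches the remaining points.\<close>

lemma kobayashi_chain_bounded_on_compact:
  fixes \<Omega> :: "(complex ^ 'n) set"
  assumes \<Omega>: "open \<Omega>" "connected \<Omega>" "x \<in> \<Omega>" and K: "compact K" "K \<subseteq> \<Omega>"
  obtains C where "\<And>y. y \<in> K \<Longrightarrow> \<exists>c\<le>C. kobayashi_chain \<Omega> x y c"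
proof -
  \<comment> \<open>The covering balls have half the radius of balls that fit into the domain, which
    keeps the cost of the last disc below \<open>artanh (1/2)\<close>.\<close>
  have "\<exists>d>0. ball y (2 * d) \<subseteq> \<Omega>" if y: "y \<in> K" for y
  proof -
    obtain e where "e > 0" "ball y e \<subseteq> \<Omega>" using \<Omega>(1) K(2) y by (meson openE subsetD)
    then show ?thesis by (intro exI[of _ "e / 2"]) auto
  qed
  then obtain d where d: "\<And>y. y \<in> K \<Longrightarrow> d y > 0" "\<And>y. y \<in> K \<Longrightarrow> ball y (2 * d y) \<subseteq> \<Omega>"
    by metis
  obtain c where c: "\<And>y. y \<in> K \<Longrightarrow> kobayashi_chain \<Omega> x y (c y)"
    using kobayashi_chain_exists[OF \<Omega>] K(2) by (metis subsetD)
  have "K \<subseteq> (\<Union>y\<in>K. ball y (d y))" using d(1) by force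
  then obtain F where F: "F \<subseteq> K" "finite F" "K \<subseteq> (\<Union>y\<in>F. ball y (d y))"
    by (rule compactE_image[OF K(1) open_ball])
  have "\<exists>e\<le>Max (c ` F) + artanh (1/2). kobayashi_chain \<Omega> x z e" if z: "z \<in> K" for z
  proof -
    obtain y where y: "y \<in> F" "z \<in> ball y (d y)" using F(3) z by blast
    have yK: "y \<in> K" using y F by blast
    then have dy: "d y > 0" "dist y z < d y" using d(1) y by auto
    have ch: "kobayashi_chain \<Omega> x z (c y + artanh (dist y z / (2 * d y)))"
      by (rule kobayashi_chain_ball(1)[OF d(2)[OF yK] _ c[OF yK]]) (use dy in auto)
    have q: "dist y z / (2 * d y) \<le> 1/2" using dy by (simp add: field_simps)
    have "artanh (dist y z / (2 * d y)) \<le> artanh (1/2)"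
      unfolding artanh_def using q dy by (intro divide_right_mono ln_mono frac_le) (auto intro!: divide_pos_pos add_pos_nonneg)
    moreover have "c y \<le> Max (c ` F)" using y F by simp
    ultimately show ?thesis using ch by (meson add_mono)
  qed
  then show thesis using that by blast
qed

text \<open>Points at depth at least \<open>\<rho>\<close> form a compact set with bounded chain
  lengths. A point closer to the boundary is joined to the centre of its interior ball, which lies
  in that set, at a cost of half the logarithm of
  \<open>2 * \<rho> / boundary_dist \<Omega> x\<close>.\<close>

lemma kobayashi_dist_le_of_interior_balls:
  fixes \<Omega> :: "(complex ^ 'n) set"
  assumes \<Omega>: "bounded_domain \<Omega>" and \<rho>: "\<rho> > 0"
    and int: "\<And>x. x \<in> \<Omega> \<Longrightarrow> boundary_dist \<Omega> x < \<rho> \<Longrightarrow>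
               \<exists>p. ball p \<rho> \<subseteq> \<Omega> \<and> dist p x = \<rho> - boundary_dist \<Omega> x"
    and x0: "x0 \<in> \<Omega>"
  shows "\<exists>C>0. \<exists>\<alpha>>0. \<forall>x\<in>\<Omega>. kobayashi_dist \<Omega> x0 x \<le> C + \<alpha> * ln (1 / boundary_dist \<Omega> x)"
proof -
  note fr = frontier_bounded_domain[OF \<Omega>]
  have con: "connected \<Omega>" and bd: "bounded \<Omega>" using \<Omega> by (auto simp: bounded_domain_def)
  define K where "K = closure \<Omega> \<inter> {y. \<rho> \<le> infdist y (frontier \<Omega>)}"
  have "compact K" unfolding K_def
    by (intro compact_Int_closed) (auto simp: bd intro!: closed_Collect_le continuous_intros)
  moreover have "K \<subseteq> \<Omega>"
  proof
    fix y assume y: "y \<in> K"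
    then have "y \<notin> frontier \<Omega>" using \<rho> by (auto simp: K_def)
    then show "y \<in> \<Omega>" using y fr(3) by (auto simp: K_def frontier_def interior_open)
  qed
  ultimately obtain C0 where C0: "\<And>y. y \<in> K \<Longrightarrow> \<exists>c\<le>C0. kobayashi_chain \<Omega> x0 y c"
    using kobayashi_chain_bounded_on_compact[OF fr(3) con x0] by metis
  obtain a where a: "a \<in> frontier \<Omega>" using fr(2) by blast
  obtain D where D: "\<And>x. x \<in> \<Omega> \<Longrightarrow> dist a x \<le> D"
    using bd bounded_any_center by blast
  define E where "E = max D 1"
  have dE: "boundary_dist \<Omega> x \<le> E" if "x \<in> \<Omega>" for x
    using infdist_le[OF a, of x] D[OF that] by (auto simp: boundary_dist_def E_def dist_commute)
  have E: "E \<ge> 1" by (simp add: E_def)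
  \<comment> \<open>The term \<open>ln E\<close> compensates for a negative logarithm at points of
    depth greater than 1; \<open>ln (2 * \<rho>)\<close> comes from the last disc, and the summand 1
    makes \<open>C\<close> positive.\<close>
  define C where "C = \<bar>C0\<bar> + \<bar>ln (2 * \<rho>)\<bar> + ln E + 1"
  have lnE: "ln E \<ge> 0" using E by simp
  have "kobayashi_dist \<Omega> x0 x \<le> C + 1/2 * ln (1 / boundary_dist \<Omega> x)" if x: "x \<in> \<Omega>" for x
  proof -
    let ?d = "boundary_dist \<Omega> x"
    have d: "0 < ?d" using boundary_dist_pos[OF \<Omega> x] .
    have lnd: "ln ?d \<le> ln E" using d dE[OF x] by simp
    show ?thesis
    proof (cases "?d < \<rho>")
      case False
      then have "x \<in> K" using x closure_subset by (auto simp: K_def boundary_dist_def)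
      then obtain c where "c \<le> C0" "kobayashi_chain \<Omega> x0 x c" using C0 by blast
      then have "kobayashi_dist \<Omega> x0 x \<le> C0" using kobayashi_dist_le by fastforce
      then show ?thesis using lnd lnE d by (simp add: ln_div C_def)
    next
      case True
      then obtain p where p: "ball p \<rho> \<subseteq> \<Omega>" "dist p x = \<rho> - ?d" using int[OF x] by blast
      \<comment> \<open>A frontier point closer to \<open>p\<close> than \<open>\<rho>\<close> would
        lie in the ball, hence in the open set that is disjoint from its frontier.\<close>
      have "\<rho> \<le> infdist p (frontier \<Omega>)"
      proof (rule ccontr)
        assume "\<not> \<rho> \<le> infdist p (frontier \<Omega>)"
        moreover obtain b where "b \<in> frontier \<Omega>" "infdist p (frontier \<Omega>) = dist p b"
          using infdist_attains_inf[OF compact_imp_closed[OF fr(1)] fr(2)] by blast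
        ultimately show False using p(1) fr(4) by (auto simp: disjoint_iff subset_iff not_le)
      qed
      moreover have "p \<in> \<Omega>" using p(1) \<rho> by auto
      ultimately have "p \<in> K" using closure_subset by (auto simp: K_def)
      then obtain c where c: "c \<le> C0" "kobayashi_chain \<Omega> x0 p c" using C0 by blast
      have "kobayashi_chain \<Omega> x0 x (c + artanh (dist p x / \<rho>))"
        by (rule kobayashi_chain_ball(1)[OF p(1) _ c(2)]) (use p d in auto)
      then have 1: "kobayashi_dist \<Omega> x0 x \<le> c + artanh (dist p x / \<rho>)" by (rule kobayashi_dist_le)
      have "1 + dist p x / \<rho> = (2 * \<rho> - ?d) / \<rho>" "1 - dist p x / \<rho> = ?d / \<rho>"
        using \<rho> by (simp_all add: p(2) field_simps)
      then have "artanh (dist p x / \<rho>) = ln ((2 * \<rho> - ?d) / ?d) / 2"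
        using \<rho> by (simp add: artanh_def)
      also have "\<dots> \<le> ln (2 * \<rho> / ?d) / 2"
        using \<rho> d True by (intro divide_right_mono ln_mono) auto
      also have "\<dots> = ln (2 * \<rho>) / 2 + 1/2 * ln (1 / ?d)" using \<rho> d by (simp add: ln_div)
      finally show ?thesis using 1 c(1) lnE unfolding C_def by linarith
    qed
  qed
  moreover have "C > 0" using lnE by (simp add: C_def)
  ultimately show ?thesis by (intro exI[of _ C] conjI exI[of _ "1/2"]) auto
qed

section \<open>Second order calculus\<close>

text \<open>The slots are ordered: \<open>u\<close> is the direction of the inner derivative and
  \<open>v\<close> that of the outer one. Linearity is established in each slot separately.\<close>

definition hess :: "('a::euclidean_space \<Rightarrow> real) \<Rightarrow> 'a \<Rightarrow> 'a \<Rightarrow> 'a \<Rightarrow> real" where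
  "hess r x u v = frechet_derivative (\<lambda>y. frechet_derivative r (at y) u) (at x) v"

context
  fixes r :: "'a::euclidean_space \<Rightarrow> real" and U
  assumes U: "open U" and C2: "Ck_on 2 U r"
begin

lemma C2_has_derivative:
  "x \<in> U \<Longrightarrow> (r has_derivative frechet_derivative r (at x)) (at x)"
  using C2 by (auto simp: numeral_2_eq_2 frechet_derivative_works)

lemma C2_linear: "x \<in> U \<Longrightarrow> linear (frechet_derivative r (at x))"
  using C2_has_derivative has_derivative_linear by blast

lemma C2_deriv_has_derivative:
  "x \<in> U \<Longrightarrow> ((\<lambda>y. frechet_derivative r (at y) u) has_derivative hess r x u) (at x)"
  using C2 unfolding hess_def by (auto simp: numeral_2_eq_2 frechet_derivative_works)

lemma continuous_on_hess: "continuous_on U (\<lambda>x. hess r x u v)"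
  using C2 by (auto simp: numeral_2_eq_2 hess_def)

lemma continuous_on_deriv: "continuous_on U (\<lambda>x. frechet_derivative r (at x) u)"
  using C2_deriv_has_derivative
  by (intro continuous_at_imp_continuous_on ballI) (rule has_derivative_continuous)

lemma linear_hess_right: "x \<in> U \<Longrightarrow> linear (hess r x u)"
  using C2_deriv_has_derivative has_derivative_linear by blast

text \<open>First derivatives are linear in the direction at every point of the open set
  \<open>U\<close>. The functions being compared thus agree near \<open>x\<close>, and uniqueness of
  the derivative transfers linearity.\<close>

lemma linear_hess_left:
  assumes x: "x \<in> U"
  shows "linear (\<lambda>u. hess r x u v)"
proof (rule linearI)
  fix u w :: 'a and c :: real
  have "((\<lambda>y. frechet_derivative r (at y) u + frechet_derivative r (at y) w)
      has_derivative (\<lambda>v. hess r x u v + hess r x w v)) (at x)"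
    by (intro has_derivative_add C2_deriv_has_derivative x)
  then have "((\<lambda>y. frechet_derivative r (at y) (u + w))
      has_derivative (\<lambda>v. hess r x u v + hess r x w v)) (at x)"
    by (rule has_derivative_transform_within_open[OF _ U x]) (simp add: linear_add[OF C2_linear])
  then show "hess r x (u + w) v = hess r x u v + hess r x w v"
    using has_derivative_unique[OF _ C2_deriv_has_derivative[OF x]] by metis
  have "((\<lambda>y. c * frechet_derivative r (at y) u) has_derivative (\<lambda>v. c * hess r x u v)) (at x)"
    by (intro has_derivative_mult_right C2_deriv_has_derivative x)
  then have "((\<lambda>y. frechet_derivative r (at y) (c *\<^sub>R u)) has_derivative (\<lambda>v. c * hess r x u v)) (at x)"
    by (rule has_derivative_transform_within_open[OF _ U x]) (simp add: linear_scale[OF C2_linear])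
  then show "hess r x (c *\<^sub>R u) v = c *\<^sub>R hess r x u v"
    using has_derivative_unique[OF _ C2_deriv_has_derivative[OF x, of "c *\<^sub>R u"]]
    by (metis real_scaleR_def)
qed

lemma deriv_basis_expansion:
  assumes "x \<in> U"
  shows "frechet_derivative r (at x) v = (\<Sum>b\<in>Basis. (v \<bullet> b) * frechet_derivative r (at x) b)"
proof -
  have "frechet_derivative r (at x) v = frechet_derivative r (at x) (\<Sum>b\<in>Basis. (v \<bullet> b) *\<^sub>R b)"
    by (simp add: euclidean_representation)
  then show ?thesis by (simp add: linear_sum[OF C2_linear[OF assms]] linear_scale[OF C2_linear[OF assms]])
qed

lemma hess_basis_expansion:
  assumes "x \<in> U"
  shows "hess r x u v = (\<Sum>b\<in>Basis. \<Sum>c\<in>Basis. (u \<bullet> b) * ((v \<bullet> c) * hess r x b c))"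
proof -
  have "hess r x u v = hess r x (\<Sum>b\<in>Basis. (u \<bullet> b) *\<^sub>R b) v"
    by (simp add: euclidean_representation)
  also have "\<dots> = (\<Sum>b\<in>Basis. (u \<bullet> b) * hess r x b v)"
    by (simp add: linear_sum[OF linear_hess_left[OF assms]] linear_scale[OF linear_hess_left[OF assms]])
  also have "\<dots> = (\<Sum>b\<in>Basis. (u \<bullet> b) * hess r x b (\<Sum>c\<in>Basis. (v \<bullet> c) *\<^sub>R c))"
    by (simp add: euclidean_representation)
  finally show ?thesis
    by (simp add: linear_sum[OF linear_hess_right[OF assms]] linear_scale[OF linear_hess_right[OF assms]]
        sum_distrib_left)
qed

text \<open>The class condition gives continuity in the base point for fixed directions only.
  Expansion over a finite basis upgrades it to joint continuity, as the compactness arguments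
  require.\<close>

lemma continuous_on_hess_quadratic: "continuous_on (U \<times> UNIV) (\<lambda>(x, v). hess r x v v)"
proof -
  have "continuous_on (U \<times> (UNIV :: 'a set))
     (\<lambda>p. \<Sum>b\<in>Basis. \<Sum>c\<in>Basis. (snd p \<bullet> b) * ((snd p \<bullet> c) * hess r (fst p) b c))"
    by (intro continuous_intros continuous_on_compose2[OF continuous_on_hess]) auto
  then show ?thesis
    by (rule continuous_on_eq) (auto simp: hess_basis_expansion)
qed

text \<open>The one-variable Maclaurin formula with Lagrange remainder for the restriction of
  \<open>r\<close> to the segment from \<open>a\<close> to \<open>a + w\<close>.\<close>

lemma C2_Taylor:
  assumes seg: "\<And>t. 0 \<le> t \<Longrightarrow> t \<le> 1 \<Longrightarrow> a + t *\<^sub>R w \<in> U"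
  obtains t where "0 \<le> t" "t \<le> 1"
    "r (a + w) = r a + frechet_derivative r (at a) w + hess r (a + t *\<^sub>R w) w w / 2"
proof -
  \<comment> \<open>The sequence of successive derivatives in the form \<open>Maclaurin2\<close>
    expects; its values beyond index 2 are fillers, since only indices below 2 are
    differentiated.\<close>
  define df where "df m t = (if m = 0 then r (a + t *\<^sub>R w)
     else if m = 1 then frechet_derivative r (at (a + t *\<^sub>R w)) w
     else hess r (a + t *\<^sub>R w) w w)" for m :: nat and t :: real
  have df: "df 0 = (\<lambda>t. r (a + t *\<^sub>R w))"
    "df 1 = (\<lambda>t. frechet_derivative r (at (a + t *\<^sub>R w)) w)"
    "df 2 = (\<lambda>t. hess r (a + t *\<^sub>R w) w w)"
    by (simp_all add: df_def fun_eq_iff)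
  have lin: "((\<lambda>t. a + t *\<^sub>R w) has_derivative (\<lambda>s. s *\<^sub>R w)) (at t)" for t
    by (auto intro!: derivative_eq_intros)
  have 0: "DERIV (df 0) t :> df 1 t" if "0 \<le> t" "t \<le> 1" for t
  proof -
    have "((\<lambda>t. r (a + t *\<^sub>R w)) has_derivative (\<lambda>s. frechet_derivative r (at (a + t *\<^sub>R w)) (s *\<^sub>R w))) (at t)"
      using has_derivative_compose[OF lin C2_has_derivative[OF seg[OF that]]] by simp
    moreover have "(\<lambda>s. frechet_derivative r (at (a + t *\<^sub>R w)) (s *\<^sub>R w)) = (*) (df 1 t)"
      unfolding df by (simp add: linear_scale[OF C2_linear[OF seg[OF that]]] fun_eq_iff)
    ultimately show ?thesis by (simp only: df(1) has_field_derivative_def)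
  qed
  have 1: "DERIV (df 1) t :> df 2 t" if "0 \<le> t" "t \<le> 1" for t
  proof -
    have "((\<lambda>t. frechet_derivative r (at (a + t *\<^sub>R w)) w) has_derivative (\<lambda>s. hess r (a + t *\<^sub>R w) w (s *\<^sub>R w))) (at t)"
      using has_derivative_compose[OF lin C2_deriv_has_derivative[OF seg[OF that]]] by simp
    moreover have "(\<lambda>s. hess r (a + t *\<^sub>R w) w (s *\<^sub>R w)) = (*) (df 2 t)"
      unfolding df by (simp add: linear_scale[OF linear_hess_right[OF seg[OF that]]] fun_eq_iff)
    ultimately show ?thesis by (simp only: df(2) has_field_derivative_def)
  qed
  have "\<exists>t. 0 < t \<and> t \<le> 1 \<and>
      r (a + 1 *\<^sub>R w) = (\<Sum>m<2. df m 0 / fact m * 1 ^ m) + df 2 t / fact 2 * 1 ^ 2"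
  proof (rule Maclaurin2)
    show "df 0 = (\<lambda>t. r (a + t *\<^sub>R w))" by (rule df(1))
    show "\<forall>m t. m < 2 \<and> 0 \<le> t \<and> t \<le> 1 \<longrightarrow> DERIV (df m) t :> df (Suc m) t"
      using 0 1 by (auto simp: numeral_2_eq_2 less_Suc_eq)
  qed simp
  then obtain t where "0 < t" "t \<le> 1"
    "r (a + 1 *\<^sub>R w) = (\<Sum>m<2. df m 0 / fact m * 1 ^ m) + df 2 t / fact 2 * 1 ^ 2"
    by blast
  then show thesis
    by (intro that[of t]) (auto simp: df_def numeral_2_eq_2)
qed

end

section \<open>Wirtinger derivatives\<close>

text \<open>The (1,0)-part of the differential of \<open>r\<close> at \<open>a\<close>. At a
  boundary point its kernel is the complex tangent space, and its zero set in \<open>z - a\<close>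
  is the complex tangent hyperplane.\<close>

definition tangent_form :: "(complex ^ 'n \<Rightarrow> real) \<Rightarrow> complex ^ 'n \<Rightarrow> complex ^ 'n \<Rightarrow> complex" where
  "tangent_form r a w = (\<Sum>j\<in>UNIV. wirtinger j (\<lambda>z. complex_of_real (r z)) a * w $ j)"

lemma tangent_form_diff: "tangent_form r a (v - w) = tangent_form r a v - tangent_form r a w"
  by (simp add: tangent_form_def algebra_simps sum_subtractf)

lemma tangent_form_cmult: "tangent_form r a (c *s w) = c * tangent_form r a w"
  by (simp add: tangent_form_def sum_distrib_left mult_ac)

lemma complex_vec_expansion:
  fixes w :: "complex ^ 'n"
  shows "w = (\<Sum>j\<in>UNIV. Re (w $ j) *\<^sub>R axis j 1 + Im (w $ j) *\<^sub>R axis j \<i>)"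
proof -
  have "(\<Sum>j\<in>UNIV. (Re (w $ j) *\<^sub>R axis j 1 + Im (w $ j) *\<^sub>R axis j \<i>) $ i) = w $ i" for i
  proof -
    have "(\<Sum>j\<in>UNIV. (Re (w $ j) *\<^sub>R axis j 1 + Im (w $ j) *\<^sub>R axis j \<i>) $ i)
        = (\<Sum>j\<in>UNIV. if i = j then w $ j else 0)"
      by (intro sum.cong) (auto simp: axis_def complex_eq_iff)
    then show ?thesis by simp
  qed
  then show ?thesis by (simp add: vec_eq_iff)
qed

lemma linear_complex_vec_expansion:
  fixes g :: "complex ^ 'n \<Rightarrow> real"
  assumes "linear g"
  shows "g w = (\<Sum>j\<in>UNIV. Re (w $ j) * g (axis j 1) + Im (w $ j) * g (axis j \<i>))"
  by (subst complex_vec_expansion[of w])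
     (simp add: linear_sum[OF assms] linear_add[OF assms] linear_scale[OF assms])

context
  fixes r :: "complex ^ 'n \<Rightarrow> real" and U
  assumes U: "open U" and C2: "Ck_on 2 U r"
begin

lemma frechet_derivative_of_real:
  assumes "x \<in> U"
  shows "frechet_derivative (\<lambda>z. complex_of_real (r z)) (at x) v = of_real (frechet_derivative r (at x) v)"
  using frechet_derivative_at[OF has_derivative_of_real[OF C2_has_derivative[OF U C2 assms]]]
  by (metis (no_types))

lemma wirtinger_eq:
  assumes "x \<in> U"
  shows "wirtinger k (\<lambda>z. complex_of_real (r z)) x =
      (of_real (frechet_derivative r (at x) (axis k 1)) - \<i> * of_real (frechet_derivative r (at x) (axis k \<i>))) / 2"
    and "wirtinger_bar k (\<lambda>z. complex_of_real (r z)) x =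
      (of_real (frechet_derivative r (at x) (axis k 1)) + \<i> * of_real (frechet_derivative r (at x) (axis k \<i>))) / 2"
  by (simp_all add: wirtinger_def wirtinger_bar_def frechet_derivative_of_real[OF assms])

lemma frechet_derivative_wirtinger:
  assumes x: "x \<in> U"
  shows "frechet_derivative (wirtinger k (\<lambda>z. complex_of_real (r z))) (at x) v =
      (of_real (hess r x (axis k 1) v) - \<i> * of_real (hess r x (axis k \<i>) v)) / 2"
    and "frechet_derivative (wirtinger_bar k (\<lambda>z. complex_of_real (r z))) (at x) v =
      (of_real (hess r x (axis k 1) v) + \<i> * of_real (hess r x (axis k \<i>) v)) / 2"
proof -
  let ?d = "\<lambda>u y. complex_of_real (frechet_derivative r (at y) u)"
  have d: "(?d u has_derivative (\<lambda>v. of_real (hess r x u v))) (at x)" for u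
    by (intro has_derivative_of_real C2_deriv_has_derivative[OF U C2 x])
  have "((\<lambda>y. (?d (axis k 1) y - \<i> * ?d (axis k \<i>) y) * (1/2)) has_derivative
      (\<lambda>v. (of_real (hess r x (axis k 1) v) - \<i> * of_real (hess r x (axis k \<i>) v)) * (1/2))) (at x)"
    by (intro has_derivative_mult_left has_derivative_diff has_derivative_mult_right d)
  then have "(wirtinger k (\<lambda>z. complex_of_real (r z)) has_derivative
      (\<lambda>v. (of_real (hess r x (axis k 1) v) - \<i> * of_real (hess r x (axis k \<i>) v)) * (1/2))) (at x)"
    by (rule has_derivative_transform_within_open[OF _ U x]) (simp add: wirtinger_eq)
  from frechet_derivative_at[OF this, symmetric]
  show "frechet_derivative (wirtinger k (\<lambda>z. complex_of_real (r z))) (at x) v =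
      (of_real (hess r x (axis k 1) v) - \<i> * of_real (hess r x (axis k \<i>) v)) / 2" by simp
  have "((\<lambda>y. (?d (axis k 1) y + \<i> * ?d (axis k \<i>) y) * (1/2)) has_derivative
      (\<lambda>v. (of_real (hess r x (axis k 1) v) + \<i> * of_real (hess r x (axis k \<i>) v)) * (1/2))) (at x)"
    by (intro has_derivative_mult_left has_derivative_add has_derivative_mult_right d)
  then have "(wirtinger_bar k (\<lambda>z. complex_of_real (r z)) has_derivative
      (\<lambda>v. (of_real (hess r x (axis k 1) v) + \<i> * of_real (hess r x (axis k \<i>) v)) * (1/2))) (at x)"
    by (rule has_derivative_transform_within_open[OF _ U x]) (simp add: wirtinger_eq)
  from frechet_derivative_at[OF this, symmetric]
  show "frechet_derivative (wirtinger_bar k (\<lambda>z. complex_of_real (r z))) (at x) v =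
      (of_real (hess r x (axis k 1) v) + \<i> * of_real (hess r x (axis k \<i>) v)) / 2" by simp
qed

text \<open>For real-valued \<open>r\<close> the differential is the sum of its (1,0)-part and the
  complex conjugate of that part.\<close>

lemma Re_tangent_form:
  assumes "x \<in> U"
  shows "2 * Re (tangent_form r x w) = frechet_derivative r (at x) w"
  unfolding tangent_form_def linear_complex_vec_expansion[OF C2_linear[OF U C2 assms], of w]
  unfolding Re_sum sum_distrib_left
  by (intro sum.cong refl) (simp add: wirtinger_eq[OF assms] field_simps)

lemma continuous_on_wirtinger: "continuous_on U (wirtinger k (\<lambda>z. complex_of_real (r z)))"
proof -
  have "continuous_on U (\<lambda>x. (complex_of_real (frechet_derivative r (at x) (axis k 1))
      - \<i> * of_real (frechet_derivative r (at x) (axis k \<i>))) / 2)"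
    by (intro continuous_intros continuous_on_deriv[OF U C2]) simp
  then show ?thesis by (rule continuous_on_eq) (simp add: wirtinger_eq)
qed

lemma continuous_on_tangent_form: "continuous_on (U \<times> UNIV) (\<lambda>(x, w). tangent_form r x w)"
  unfolding tangent_form_def case_prod_unfold
  by (intro continuous_intros continuous_on_compose2[OF continuous_on_wirtinger]) auto

text \<open>The real Hessian splits into the Levi form and the real part of the holomorphic
  quadratic form. This is how the strong linear convexity inequality becomes positivity of the
  Hessian on complex tangent vectors.\<close>

lemma hess_eq_wirtinger:
  assumes x: "x \<in> U"
  shows "hess r x v v =
     2 * Re (\<Sum>j\<in>UNIV. \<Sum>k\<in>UNIV. wirtinger j (wirtinger_bar k (\<lambda>z. complex_of_real (r z))) x * v $ j * cnj (v $ k))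
   + 2 * Re (\<Sum>j\<in>UNIV. \<Sum>k\<in>UNIV. wirtinger j (wirtinger k (\<lambda>z. complex_of_real (r z))) x * v $ j * v $ k)"
proof -
  have "hess r x v v = (\<Sum>k\<in>UNIV. Re (v $ k) * hess r x (axis k 1) v + Im (v $ k) * hess r x (axis k \<i>) v)"
    by (rule linear_complex_vec_expansion[OF linear_hess_left[OF U C2 x]])
  also have "\<dots> = (\<Sum>k\<in>UNIV. \<Sum>j\<in>UNIV.
      Re (v $ k) * (Re (v $ j) * hess r x (axis k 1) (axis j 1) + Im (v $ j) * hess r x (axis k 1) (axis j \<i>))
    + Im (v $ k) * (Re (v $ j) * hess r x (axis k \<i>) (axis j 1) + Im (v $ j) * hess r x (axis k \<i>) (axis j \<i>)))"
    by (intro sum.cong refl, subst (1 2) linear_complex_vec_expansion[OF linear_hess_right[OF U C2 x]])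
       (simp only: sum_distrib_left sum.distrib distrib_left)
  also have "\<dots> = (\<Sum>j\<in>UNIV. \<Sum>k\<in>UNIV.
      2 * Re (wirtinger j (wirtinger_bar k (\<lambda>z. complex_of_real (r z))) x * v $ j * cnj (v $ k))
    + 2 * Re (wirtinger j (wirtinger k (\<lambda>z. complex_of_real (r z))) x * v $ j * v $ k))"
    \<comment> \<open>The expansion of the Hessian sums over the inner direction \<open>k\<close>
      first, the Wirtinger sums over the outer direction \<open>j\<close>; after the swap the terms
      match one by one.\<close>
    apply (subst sum.swap)
    apply (intro sum.cong refl)
    apply (simp add: wirtinger_def[of _ "wirtinger _ _"] wirtinger_def[of _ "wirtinger_bar _ _"]
        frechet_derivative_wirtinger[OF x])
    apply (simp add: field_simps)
    done
  finally show ?thesis by (simp add: sum_distrib_left sum.distrib)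
qed

end

lemma scaleR_eq_vector_scalar_mult:
  fixes v :: "complex ^ 'n"
  shows "t *\<^sub>R v = of_real t *s v"
  by (simp add: vec_eq_iff) (simp add: scaleR_conv_of_real)

section \<open>Domains with twice differentiable boundary\<close>

locale C2_domain =
  fixes \<Omega> :: "(complex ^ 'n) set" and U r
  assumes domain: "bounded_domain \<Omega>"
    and defining: "defining_function \<Omega> U r"
    and C2: "Ck_on 2 U r"
begin

lemmas frontier_facts = frontier_bounded_domain[OF domain]

lemma open_U: "open U"
  using defining by (simp add: defining_function_def)

lemma frontier_U: "a \<in> frontier \<Omega> \<Longrightarrow> a \<in> U"
  using defining by (auto simp: defining_function_def)

lemma r_frontier: "a \<in> frontier \<Omega> \<Longrightarrow> r a = 0"
  using defining by (auto simp: defining_function_def)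

lemma in_domain_iff: "z \<in> U \<Longrightarrow> z \<in> \<Omega> \<longleftrightarrow> r z < 0"
  using defining by (auto simp: defining_function_def)

lemma deriv_nonzero: "a \<in> frontier \<Omega> \<Longrightarrow> \<exists>v. frechet_derivative r (at a) v \<noteq> 0"
  using defining by (auto simp: defining_function_def fun_eq_iff)

text \<open>A compact neighbourhood of the frontier inside \<open>U\<close>: Taylor segments issuing
  from the frontier stay in it, and continuous second order quantities are bounded on it.\<close>

lemma collar:
  obtains \<sigma> where "\<sigma> > 0" "{y. infdist y (frontier \<Omega>) \<le> \<sigma>} \<subseteq> U" "compact {y. infdist y (frontier \<Omega>) \<le> \<sigma>}"
proof -
  obtain \<sigma> where \<sigma>: "\<sigma> > 0" "(\<Union>x\<in>frontier \<Omega>. cball x \<sigma>) \<subseteq> U"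
    using compact_subset_open_imp_cball_epsilon_subset[OF frontier_facts(1) open_U] frontier_U by blast
  have "y \<in> U" if "infdist y (frontier \<Omega>) \<le> \<sigma>" for y
  proof -
    obtain b where b: "b \<in> frontier \<Omega>" "infdist y (frontier \<Omega>) = dist y b"
      using infdist_attains_inf[OF compact_imp_closed[OF frontier_facts(1)] frontier_facts(2)] by blast
    then have "y \<in> cball b \<sigma>" using that by (simp add: dist_commute)
    then show ?thesis using \<sigma>(2) b(1) by blast
  qed
  then show thesis
    using that[OF \<sigma>(1)] compact_infdist_le[OF frontier_facts(2,1) \<sigma>(1)] by blast
qed

lemma nearest_frontier_point:
  obtains a where "a \<in> frontier \<Omega>" "boundary_dist \<Omega> x = dist x a"
  unfolding boundary_dist_def
  using infdist_attains_inf[OF compact_imp_closed[OF frontier_facts(1)] frontier_facts(2)] by blast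

text \<open>By connectedness a ball that leaves the domain meets the frontier, at a distance below
  the infimum.\<close>

lemma ball_boundary_dist_subset:
  assumes x: "x \<in> \<Omega>"
  shows "ball x (boundary_dist \<Omega> x) \<subseteq> \<Omega>"
proof (rule ccontr)
  assume "\<not> ?thesis"
  then obtain y where y: "y \<in> ball x (boundary_dist \<Omega> x)" "y \<notin> \<Omega>" by blast
  then have "x \<in> ball x (boundary_dist \<Omega> x)" by (auto intro: le_less_trans[OF zero_le_dist])
  then have "ball x (boundary_dist \<Omega> x) \<inter> frontier \<Omega> \<noteq> {}"
    using y x by (intro connected_Int_frontier connected_ball) blast+
  then obtain b where "b \<in> frontier \<Omega>" "dist x b < boundary_dist \<Omega> x" by auto
  then show False using infdist_le[of b "frontier \<Omega>" x] by (simp add: boundary_dist_def)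
qed

section \<open>Complex tangent hyperplanes at boundary points\<close>

lemma DERIV_line:
  assumes a: "a \<in> frontier \<Omega>"
  shows "DERIV (\<lambda>t. r (a + t *\<^sub>R v)) 0 :> frechet_derivative r (at a) v"
proof -
  have aU: "a \<in> U" using frontier_U[OF a] .
  have lin: "((\<lambda>t. a + t *\<^sub>R v) has_derivative (\<lambda>s. s *\<^sub>R v)) (at 0)"
    by (auto intro!: derivative_eq_intros)
  have "(r has_derivative frechet_derivative r (at a)) (at (a + 0 *\<^sub>R v))"
    using C2_has_derivative[OF open_U C2 aU] by simp
  from has_derivative_compose[OF lin this]
  have "((\<lambda>t. r (a + t *\<^sub>R v)) has_derivative (\<lambda>s. frechet_derivative r (at a) (s *\<^sub>R v))) (at 0)" .
  moreover have "(\<lambda>s. frechet_derivative r (at a) (s *\<^sub>R v)) = (*) (frechet_derivative r (at a) v)"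
    by (simp add: linear_scale[OF C2_linear[OF open_U C2 aU]] fun_eq_iff)
  ultimately show ?thesis
    by (simp only: has_field_derivative_def)
qed

lemma enters_domain:
  assumes a: "a \<in> frontier \<Omega>" and v: "frechet_derivative r (at a) v < 0"
  shows "\<exists>d>0. \<forall>t. 0 < t \<longrightarrow> t < d \<longrightarrow> a + t *\<^sub>R v \<in> \<Omega>"
proof -
  have aU: "a \<in> U" using frontier_U[OF a] .
  from DERIV_neg_dec_right[OF DERIV_line[OF a] v] obtain d1 where
    d1: "d1 > 0" "\<And>h. h > 0 \<Longrightarrow> h < d1 \<Longrightarrow> r (a + h *\<^sub>R v) < 0"
    by (auto simp: r_frontier[OF a])
  obtain e where e: "e > 0" "ball a e \<subseteq> U" using aU open_U openE by blast
  \<comment> \<open>Keeps the points inside \<open>U\<close>, where the sign of \<open>r\<close>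
    decides membership; the added 1 avoids a division by zero.\<close>
  define d2 where "d2 = e / (norm v + 1)"
  have d2: "d2 > 0" using e by (simp add: d2_def add_nonneg_pos)
  have "a + t *\<^sub>R v \<in> U" if "0 < t" "t < d2" for t
  proof -
    have "t * norm v \<le> t * (norm v + 1)" using that by simp
    also have "\<dots> < e" using that by (simp add: d2_def pos_less_divide_eq add_nonneg_pos)
    finally show ?thesis using e(2) that by (auto simp: subset_iff dist_norm)
  qed
  then show ?thesis using d1 d2 in_domain_iff by (intro exI[of _ "min d1 d2"]) auto
qed

text \<open>The hyperplane through \<open>a\<close> supplied by linear convexity must be the complex
  tangent one. A direction in it along which \<open>r\<close> decreases would lead into the domain,
  so \<open>tangent_form\<close> vanishes on the kernel of \<open>l\<close> and is a nonzero
  multiple of \<open>l\<close>.\<close>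

lemma tangent_form_nonvanishing:
  assumes lc: "linearly_convex \<Omega>" and a: "a \<in> frontier \<Omega>" and z: "z \<in> \<Omega>"
  shows "tangent_form r a (z - a) \<noteq> 0"
proof
  assume La: "tangent_form r a (z - a) = 0"
  have aU: "a \<in> U" using frontier_U[OF a] .
  have "a \<notin> \<Omega>" using a frontier_facts(4) by blast
  then obtain c b where cb: "c \<noteq> 0" "(\<Sum>j\<in>UNIV. c $ j * a $ j) = b"
    "{z. (\<Sum>j\<in>UNIV. c $ j * z $ j) = b} \<inter> \<Omega> = {}"
    using lc unfolding linearly_convex_def complex_hyperplane_def by blast
  define l where "l w = (\<Sum>j\<in>UNIV. c $ j * w $ j)" for w :: "complex ^ 'n"
  have l: "l (v + w) = l v + l w" "l (v - w) = l v - l w" "l (k *s v) = k * l v" for v w k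
    by (simp_all add: l_def algebra_simps sum.distrib sum_subtractf sum_distrib_left)
  have nonneg: "0 \<le> Re (tangent_form r a w)" if "l w = 0" for w
  proof (rule ccontr)
    assume "\<not> 0 \<le> Re (tangent_form r a w)"
    then have "frechet_derivative r (at a) w < 0"
      using Re_tangent_form[OF open_U C2 aU, of w] by simp
    then obtain d where "d > 0" "\<And>t. 0 < t \<Longrightarrow> t < d \<Longrightarrow> a + t *\<^sub>R w \<in> \<Omega>"
      using enters_domain[OF a] by blast
    then have "a + (d/2) *\<^sub>R w \<in> \<Omega>" by simp
    moreover have "l (a + (d/2) *\<^sub>R w) = b" using that cb(2) by (simp add: l scaleR_eq_vector_scalar_mult) (simp add: l_def)
    ultimately show False using cb(3) unfolding l_def by blast
  qed
  \<comment> \<open>The kernel of \<open>l\<close> is invariant under complex scalars, so the sign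
    condition at 1, -1, \<i> and -\<i> kills both the real and the imaginary part.\<close>
  have zero: "tangent_form r a w = 0" if "l w = 0" for w
  proof -
    have "0 \<le> Re (k * tangent_form r a w)" for k
      using nonneg[of "k *s w"] that by (simp add: l tangent_form_cmult)
    from this[of 1] this[of "-1"] this[of \<i>] this[of "-\<i>"] show ?thesis
      by (simp add: complex_eq_iff)
  qed
  obtain j where j: "c $ j \<noteq> 0" using cb(1) by (auto simp: vec_eq_iff)
  define u where "u = axis j (1 / c $ j)"
  have "l u = (\<Sum>i\<in>UNIV. if i = j then 1 else 0)"
    unfolding l_def u_def using j by (intro sum.cong) (auto simp: axis_def)
  then have lu: "l u = 1" by simp
  have factor: "tangent_form r a w = l w * tangent_form r a u" for w
    using zero[of "w - l w *s u"] by (simp add: l lu tangent_form_diff tangent_form_cmult)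
  have "l z \<noteq> b" using cb(3) z by (auto simp: l_def)
  then have "l (z - a) \<noteq> 0" using cb(2) by (simp add: l) (simp add: l_def)
  then have "tangent_form r a u = 0" using factor[of "z - a"] La by simp
  then have "tangent_form r a w = 0" for w using factor[of w] by simp
  then have "frechet_derivative r (at a) w = 0" for w
    using Re_tangent_form[OF open_U C2 aU, of w] by simp
  then show False using deriv_nonzero[OF a] by blast
qed

lemma tangent_form_bound:
  obtains M where "M > 0" "\<And>a w. a \<in> frontier \<Omega> \<Longrightarrow> cmod (tangent_form r a w) \<le> M * norm w"
proof -
  let ?g = "\<lambda>a. \<Sum>j\<in>UNIV. cmod (wirtinger j (\<lambda>z. complex_of_real (r z)) a)"
  have "continuous_on (frontier \<Omega>) ?g"
    by (intro continuous_intros continuous_on_subset[OF continuous_on_wirtinger[OF open_U C2]])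
       (auto intro: frontier_U)
  then have "bounded (?g ` frontier \<Omega>)"
    using frontier_facts(1) compact_continuous_image compact_imp_bounded by blast
  then obtain M where M: "M > 0" "\<And>a. a \<in> frontier \<Omega> \<Longrightarrow> norm (?g a) \<le> M"
    unfolding bounded_pos by blast
  show thesis
  proof (rule that[OF M(1)])
    fix a w assume a: "a \<in> frontier \<Omega>"
    have "cmod (tangent_form r a w) \<le> (\<Sum>j\<in>UNIV. cmod (wirtinger j (\<lambda>z. complex_of_real (r z)) a) * norm w)"
      unfolding tangent_form_def
      by (intro sum_norm_le) (auto simp: norm_mult intro!: mult_left_mono Finite_Cartesian_Product.norm_nth_le)
    also have "\<dots> = ?g a * norm w" by (simp add: sum_distrib_right)
    also have "\<dots> \<le> M * norm w" using M(2)[OF a] by (intro mult_right_mono) auto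
    finally show "cmod (tangent_form r a w) \<le> M * norm w" .
  qed
qed

lemma Taylor_collar:
  assumes \<sigma>: "{y. infdist y (frontier \<Omega>) \<le> \<sigma>} \<subseteq> U"
    and a: "a \<in> frontier \<Omega>" and w: "norm w \<le> \<sigma>"
  obtains y where "dist y a \<le> norm w" "infdist y (frontier \<Omega>) \<le> \<sigma>"
    "r (a + w) = frechet_derivative r (at a) w + hess r y w w / 2"
proof -
  have near: "dist (a + t *\<^sub>R w) a \<le> norm w" if "0 \<le> t" "t \<le> 1" for t
    using that by (simp add: dist_norm mult_left_le_one_le)
  have collar: "infdist (a + t *\<^sub>R w) (frontier \<Omega>) \<le> \<sigma>" if "0 \<le> t" "t \<le> 1" for t
    using infdist_le[OF a, of "a + t *\<^sub>R w"] near[OF that] w by linarith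
  obtain t where t: "0 \<le> t" "t \<le> 1"
    "r (a + w) = r a + frechet_derivative r (at a) w + hess r (a + t *\<^sub>R w) w w / 2"
    by (rule C2_Taylor[OF open_U C2, of a w]) (use collar \<sigma> in blast)+
  show thesis
    using that[OF near[OF t(1,2)] collar[OF t(1,2)]] t(3) r_frontier[OF a] by simp
qed

lemma hess_quadratic:
  assumes "x \<in> U"
  shows "hess r x (c *\<^sub>R v) (c *\<^sub>R v) = c\<^sup>2 * hess r x v v"
  by (simp add: linear_scale[OF linear_hess_left[OF open_U C2 assms]]
      linear_scale[OF linear_hess_right[OF open_U C2 assms]] power2_eq_square)

text \<open>The complex tangent hyperplane has contact of order exactly two with the boundary.  Otherwise
  the second order Taylor expansion, along a sequence of rescaled counterexamples, would produce
  a complex tangent vector on which the real Hessian is not positive.\<close>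

lemma tangent_form_contact:
  assumes pos: "\<And>a X. a \<in> frontier \<Omega> \<Longrightarrow> X \<noteq> 0 \<Longrightarrow> tangent_form r a X = 0 \<Longrightarrow> 0 < hess r a X X"
  obtains c \<sigma> where "c > 0" "\<sigma> > 0"
    "\<And>a z. a \<in> frontier \<Omega> \<Longrightarrow> z \<in> \<Omega> \<Longrightarrow> dist z a < \<sigma> \<Longrightarrow>
       c * (dist z a)\<^sup>2 \<le> cmod (tangent_form r a (z - a))"
proof -
  obtain \<sigma>0 where \<sigma>0: "\<sigma>0 > 0" "{y. infdist y (frontier \<Omega>) \<le> \<sigma>0} \<subseteq> U"
    using collar by metis
  \<comment> \<open>\<open>e n\<close> serves both as the contact constant and as the radius, so
    that the failure of all \<open>n\<close> yields counterexamples for which both tend to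
    0.\<close>
  define e where "e n = min \<sigma>0 (1 / real (Suc n))" for n
  have e: "e n > 0" "e n \<le> \<sigma>0" "e n \<le> 1 / real (Suc n)" for n
    using \<sigma>0(1) by (auto simp: e_def)
  have "\<exists>n. \<forall>a z. a \<in> frontier \<Omega> \<longrightarrow> z \<in> \<Omega> \<longrightarrow> dist z a < e n \<longrightarrow>
      e n * (dist z a)\<^sup>2 \<le> cmod (tangent_form r a (z - a))"
  proof (rule ccontr)
    assume "\<not> ?thesis"
    then have "\<forall>n. \<exists>a z. a \<in> frontier \<Omega> \<and> z \<in> \<Omega> \<and> dist z a < e n \<and>
      cmod (tangent_form r a (z - a)) < e n * (dist z a)\<^sup>2"
      by (meson not_le)
    then obtain a z where az: "\<And>n. a n \<in> frontier \<Omega>" "\<And>n. z n \<in> \<Omega>" "\<And>n. dist (z n) (a n) < e n"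
      "\<And>n. cmod (tangent_form r (a n) (z n - a n)) < e n * (dist (z n) (a n))\<^sup>2"
      by metis
    define d where "d n = dist (z n) (a n)" for n
    define X where "X n = (1 / d n) *\<^sub>R (z n - a n)" for n
    have d: "0 < d n" for n
    proof -
      have "z n \<noteq> a n" using az(1,2) frontier_facts(4) by (metis disjoint_iff)
      then show ?thesis by (simp add: d_def)
    qed
    have X: "norm (X n) = 1" for n using d[of n] by (simp add: X_def d_def dist_norm)
    have zX: "z n - a n = d n *\<^sub>R X n" for n using d[of n] by (simp add: X_def)
    \<comment> \<open>Rescaling to unit length leaves a bound that tends to 0, so every limit of the
      directions \<open>X n\<close> is complex tangent.\<close>
    have tX: "cmod (tangent_form r (a n) (X n)) < e n * d n" for n
    proof -
      have "cmod (tangent_form r (a n) (z n - a n)) = d n * cmod (tangent_form r (a n) (X n))"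
        unfolding zX using d[of n] by (simp add: scaleR_eq_vector_scalar_mult tangent_form_cmult norm_mult)
      then have "d n * cmod (tangent_form r (a n) (X n)) < d n * (e n * d n)"
        using az(4)[of n] by (simp add: d_def power2_eq_square mult_ac)
      then show ?thesis using d[of n] by simp
    qed
    \<comment> \<open>As \<open>r (z n) < 0\<close> and the linear term is at least
      \<open>- 2 * e n * (d n)\<^sup>2\<close>, the quadratic term
      \<open>(d n)\<^sup>2 * hess / 2\<close> stays below \<open>2 * e n * (d n)\<^sup>2\<close>;
      hence the factor 4.\<close>
    have "\<exists>y. dist y (a n) \<le> d n \<and> y \<in> U \<and> hess r y (X n) (X n) \<le> 4 * e n" for n
    proof -
      have "norm (z n - a n) \<le> \<sigma>0" using az(3)[of n] e(2)[of n] by (simp add: dist_norm)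
      then obtain y where y: "dist y (a n) \<le> norm (z n - a n)" "infdist y (frontier \<Omega>) \<le> \<sigma>0"
        "r (a n + (z n - a n)) = frechet_derivative r (at (a n)) (z n - a n) + hess r y (z n - a n) (z n - a n) / 2"
        using Taylor_collar[OF \<sigma>0(2) az(1)] by metis
      have yU: "y \<in> U" using y(2) \<sigma>0(2) by blast
      have "infdist (z n) (frontier \<Omega>) \<le> \<sigma>0"
        using infdist_le[OF az(1), of "z n" n] az(3)[of n] e(2)[of n] by linarith
      then have "r (z n) < 0" using in_domain_iff az(2) \<sigma>0(2) by blast
      then have "2 * Re (tangent_form r (a n) (z n - a n)) + (d n)\<^sup>2 * hess r y (X n) (X n) / 2 < 0"
        using y(3) by (simp add: Re_tangent_form[OF open_U C2 frontier_U[OF az(1)]])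
          (simp add: zX hess_quadratic[OF yU])
      moreover have "- (e n * (d n)\<^sup>2) \<le> Re (tangent_form r (a n) (z n - a n))"
        using az(4)[of n] abs_Re_le_cmod[of "tangent_form r (a n) (z n - a n)"] by (simp add: d_def)
      ultimately have "(d n)\<^sup>2 * hess r y (X n) (X n) \<le> (d n)\<^sup>2 * (4 * e n)" by (simp add: algebra_simps)
      then have "hess r y (X n) (X n) \<le> 4 * e n" using d[of n] by simp
      then show ?thesis using y(1) yU by (auto simp: d_def dist_norm)
    qed
    then obtain y where y: "\<And>n. dist (y n) (a n) \<le> d n" "\<And>n. y n \<in> U"
      "\<And>n. hess r (y n) (X n) (X n) \<le> 4 * e n" by metis
    have cpt: "compact (frontier \<Omega> \<times> sphere (0 :: complex ^ 'n) 1)"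
      by (intro compact_Times frontier_facts compact_sphere)
    have "(a n, X n) \<in> frontier \<Omega> \<times> sphere 0 1" for n using az(1) X by simp
    from cpt[unfolded compact_def, rule_format, of "\<lambda>n. (a n, X n)", OF this] obtain p s where p: "p \<in> frontier \<Omega> \<times> sphere 0 1" and s: "strict_mono s"
      and lim: "((\<lambda>n. (a n, X n)) \<circ> s) \<longlonglongrightarrow> p"
      by blast
    obtain a' X' where p': "p = (a', X')" by force
    have a': "a' \<in> frontier \<Omega>" "a' \<in> U" "X' \<noteq> 0" using p p' frontier_U by auto
    have lima: "(\<lambda>n. a (s n)) \<longlonglongrightarrow> a'" and limX: "(\<lambda>n. X (s n)) \<longlonglongrightarrow> X'"
      using tendsto_fst[OF lim] tendsto_snd[OF lim] by (simp_all add: p' o_def)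
    have "e \<longlonglongrightarrow> 0"
      by (rule tendsto_sandwich[OF _ _ tendsto_const LIMSEQ_Suc[OF lim_1_over_n]])
         (use e in \<open>auto intro!: always_eventually less_imp_le\<close>)
    then have lime: "(\<lambda>n. e (s n)) \<longlonglongrightarrow> 0" using LIMSEQ_subseq_LIMSEQ[OF _ s] by (simp add: o_def)
    have limd: "(\<lambda>n. d (s n)) \<longlonglongrightarrow> 0"
      by (rule tendsto_sandwich[OF _ _ tendsto_const lime])
         (use d az(3) in \<open>auto simp: d_def intro!: always_eventually less_imp_le\<close>)
    \<comment> \<open>The Taylor points lie within \<open>d n\<close> of the base points and so
      share their limit, where the Hessian is then both positive and at most 0.\<close>
    have "(\<lambda>n. y (s n) - a (s n)) \<longlonglongrightarrow> 0"
      by (rule Lim_null_comparison[OF _ limd]) (use y(1) in \<open>auto simp: dist_norm intro!: always_eventually\<close>)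
    from tendsto_add[OF this lima] have limy: "(\<lambda>n. y (s n)) \<longlonglongrightarrow> a'" by simp
    have op: "open (U \<times> (UNIV :: (complex ^ 'n) set))" by (intro open_Times open_U open_UNIV)
    have "isCont (\<lambda>(x, v). tangent_form r x v) (a', X')"
      using continuous_on_tangent_form[OF open_U C2] continuous_on_eq_continuous_at[OF op] a'(2) by blast
    from isCont_tendsto_compose[OF this tendsto_Pair[OF lima limX]]
    have 1: "(\<lambda>n. tangent_form r (a (s n)) (X (s n))) \<longlonglongrightarrow> tangent_form r a' X'" by simp
    have "(\<lambda>n. e (s n) * d (s n)) \<longlonglongrightarrow> 0" using tendsto_mult[OF lime limd] by simp
    then have "(\<lambda>n. tangent_form r (a (s n)) (X (s n))) \<longlonglongrightarrow> 0"
      by (rule Lim_null_comparison[rotated]) (auto intro!: always_eventually less_imp_le[OF tX])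
    with 1 have "tangent_form r a' X' = 0" using LIMSEQ_unique by blast
    then have "0 < hess r a' X' X'" using pos a' by blast
    moreover have "isCont (\<lambda>(x, v). hess r x v v) (a', X')"
      using continuous_on_hess_quadratic[OF open_U C2] continuous_on_eq_continuous_at[OF op] a'(2) by blast
    from isCont_tendsto_compose[OF this tendsto_Pair[OF limy limX]]
    have "(\<lambda>n. hess r (y (s n)) (X (s n)) (X (s n))) \<longlonglongrightarrow> hess r a' X' X'" by simp
    then have "hess r a' X' X' \<le> 4 * 0"
      by (rule LIMSEQ_le[OF _ tendsto_mult[OF tendsto_const lime]]) (use y(3) in blast)
    ultimately show False by simp
  qed
  then show thesis using that e(1) by blast
qed

section \<open>Interior tangent balls of uniform radius\<close>

lemma gradient_bound:
  obtains G m where "m > 0"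
    "\<And>a w. a \<in> frontier \<Omega> \<Longrightarrow> frechet_derivative r (at a) w = inner (G a) w"
    "\<And>a. a \<in> frontier \<Omega> \<Longrightarrow> m \<le> norm (G a)"
proof -
  define G where "G a = (\<Sum>b\<in>Basis. frechet_derivative r (at a) b *\<^sub>R b)" for a
  have G: "frechet_derivative r (at a) w = inner (G a) w" if "a \<in> frontier \<Omega>" for a w
    unfolding G_def using deriv_basis_expansion[OF open_U C2 frontier_U[OF that], of w]
    by (simp add: inner_sum_left) (intro sum.cong, simp_all add: inner_commute mult.commute)
  have "continuous_on (frontier \<Omega>) (\<lambda>a. norm (G a))"
    unfolding G_def
    by (intro continuous_intros continuous_on_subset[OF continuous_on_deriv[OF open_U C2]])
       (auto intro: frontier_U)
  from continuous_attains_inf[OF frontier_facts(1,2) this]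
  obtain a0 where a0: "a0 \<in> frontier \<Omega>" "\<And>a. a \<in> frontier \<Omega> \<Longrightarrow> norm (G a0) \<le> norm (G a)" by blast
  have "G a0 \<noteq> 0" using deriv_nonzero[OF a0(1)] G[OF a0(1)] by auto
  then show thesis using that[of "norm (G a0)" G] G a0(2) by simp
qed

text \<open>At a nearest boundary point \<open>a\<close> the gradient points opposite to
  \<open>n\<close>, the direction of \<open>x - a\<close>. For \<open>w\<close> in the ball of
  radius \<open>\<rho>\<close> tangent at \<open>a\<close>, the linear term
  \<open>- m * inner w n\<close> dominates the quadratic remainder, so \<open>r\<close> is negative
  on that ball.\<close>

lemma interior_balls:
  obtains \<rho> where "\<rho> > 0"
    "\<And>x. x \<in> \<Omega> \<Longrightarrow> boundary_dist \<Omega> x < \<rho> \<Longrightarrow>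
       \<exists>p. ball p \<rho> \<subseteq> \<Omega> \<and> dist p x = \<rho> - boundary_dist \<Omega> x"
proof -
  obtain \<sigma> where \<sigma>: "\<sigma> > 0" "{y. infdist y (frontier \<Omega>) \<le> \<sigma>} \<subseteq> U"
    "compact {y. infdist y (frontier \<Omega>) \<le> \<sigma>}" using collar by metis
  obtain G m where m: "m > 0"
    "\<And>a w. a \<in> frontier \<Omega> \<Longrightarrow> frechet_derivative r (at a) w = inner (G a) w"
    "\<And>a. a \<in> frontier \<Omega> \<Longrightarrow> m \<le> norm (G a)" using gradient_bound by metis
  let ?K = "{y. infdist y (frontier \<Omega>) \<le> \<sigma>} \<times> sphere (0 :: complex ^ 'n) 1"
  have "continuous_on ?K (\<lambda>(x, v). hess r x v v)"
    by (rule continuous_on_subset[OF continuous_on_hess_quadratic[OF open_U C2]]) (use \<sigma>(2) in auto)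
  moreover have "compact ?K" by (intro compact_Times \<sigma> compact_sphere)
  ultimately have "bounded ((\<lambda>(x, v). hess r x v v) ` ?K)"
    using compact_continuous_image compact_imp_bounded by blast
  then obtain M where M: "M > 0" "\<And>p. p \<in> ?K \<Longrightarrow> norm ((\<lambda>(x, v). hess r x v v) p) \<le> M"
    unfolding bounded_pos by blast
  have hM: "hess r y w w \<le> M * (norm w)\<^sup>2" if y: "infdist y (frontier \<Omega>) \<le> \<sigma>" for y w
  proof (cases "w = 0")
    case True
    have "y \<in> U" using y \<sigma>(2) by blast
    then show ?thesis using True hess_quadratic[of y 0 w] by simp
  next
    case False
    have yU: "y \<in> U" using y \<sigma>(2) by blast
    let ?v = "(1 / norm w) *\<^sub>R w"
    have "hess r y ?v ?v \<le> M" using M(2)[of "(y, ?v)"] y False by simp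
    then have "(norm w)\<^sup>2 * hess r y ?v ?v \<le> (norm w)\<^sup>2 * M" by (intro mult_left_mono) auto
    moreover have "(norm w)\<^sup>2 * hess r y ?v ?v = hess r y w w"
      using hess_quadratic[OF yU, of "norm w" ?v] False by simp
    ultimately show ?thesis by (simp add: mult.commute)
  qed
  \<comment> \<open>The first bound keeps the whole ball, whose points are within
    \<open>2 * \<rho>\<close> of \<open>a\<close>, inside the collar; the second is the balance
    \<open>M * \<rho> \<le> m\<close> between the two Taylor terms.\<close>
  define \<rho> where "\<rho> = min (\<sigma> / 2) (m / M)"
  have \<rho>: "\<rho> > 0" "2 * \<rho> \<le> \<sigma>" "M * \<rho> \<le> m"
    using \<sigma>(1) m(1) M(1) by (auto simp: \<rho>_def field_simps min_def)
  have "\<exists>p. ball p \<rho> \<subseteq> \<Omega> \<and> dist p x = \<rho> - boundary_dist \<Omega> x"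
    if x: "x \<in> \<Omega>" and xd: "boundary_dist \<Omega> x < \<rho>" for x
  proof -
    let ?d = "boundary_dist \<Omega> x"
    obtain a where a: "a \<in> frontier \<Omega>" "?d = dist x a" using nearest_frontier_point .
    have d: "0 < ?d" using boundary_dist_pos[OF domain x] .
    define n where "n = (1 / ?d) *\<^sub>R (x - a)"
    have n1: "norm n = 1" using d a(2) by (simp add: n_def dist_norm)
    have xa: "x - a = ?d *\<^sub>R n" using d by (simp add: n_def)
    \<comment> \<open>A small step from \<open>a\<close> in a direction with positive component
      along \<open>n\<close> enters the ball about \<open>x\<close> of radius \<open>?d\<close>,
      which lies in the domain; \<open>r\<close> cannot increase to first order there.\<close>
    have inward: "inner (G a) v \<le> 0" if v: "inner v n > 0" for v
    proof (rule ccontr)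
      assume "\<not> inner (G a) v \<le> 0"
      then have "frechet_derivative r (at a) (- v) < 0" by (simp add: m(2)[OF a(1)])
      then have pos: "frechet_derivative r (at a) v > 0"
        using linear_neg[OF C2_linear[OF open_U C2 frontier_U[OF a(1)]]] by simp
      have aU: "a \<in> U" using frontier_U[OF a(1)] .
from DERIV_pos_inc_right[OF DERIV_line[OF a(1)] pos] obtain d1 where
        d1: "d1 > 0" "\<And>h. h > 0 \<Longrightarrow> h < d1 \<Longrightarrow> r (a + h *\<^sub>R v) > 0"
        by (auto simp: r_frontier[OF a(1)])
      obtain e where e: "e > 0" "ball a e \<subseteq> U" using aU open_U openE by blast
      have v0: "v \<noteq> 0" using v by auto
      \<comment> \<open>The three bounds keep \<open>r\<close> positive, the point in
        \<open>U\<close>, and the point in the ball about \<open>x\<close>; the last is what makes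
        \<open>norm (h *\<^sub>R v - ?d *\<^sub>R n)\<close> smaller than \<open>?d\<close>.\<close>
      define h where "h = min (d1 / 2) (min (e / (2 * norm v)) (?d * inner v n / (norm v)\<^sup>2))"
      have h: "h > 0" "h < d1" "h * norm v < e" "h * (norm v)\<^sup>2 \<le> ?d * inner v n"
      proof -
        show "h > 0" using d1(1) e(1) d v v0 by (simp add: h_def)
        show "h < d1" using d1(1) by (simp add: h_def min_def)
        have "h \<le> e / (2 * norm v)" by (simp add: h_def)
        then have "h * norm v \<le> e / 2" using v0 by (simp add: field_simps)
        then show "h * norm v < e" using e(1) by linarith
        have "h \<le> ?d * inner v n / (norm v)\<^sup>2" by (simp add: h_def)
        then show "h * (norm v)\<^sup>2 \<le> ?d * inner v n" using v0 by (simp add: field_simps)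
      qed
      have "(norm (h *\<^sub>R v - ?d *\<^sub>R n))\<^sup>2 = h * (h * (norm v)\<^sup>2) - 2 * h * (?d * inner v n) + ?d\<^sup>2"
        unfolding power2_norm_eq_inner
        using n1[unfolded norm_eq_1] by (simp add: inner_diff_left inner_diff_right inner_commute power2_eq_square algebra_simps)
      also have "\<dots> \<le> h * (?d * inner v n) - 2 * h * (?d * inner v n) + ?d\<^sup>2"
        using h by (intro add_right_mono diff_right_mono mult_left_mono) auto
      also have "\<dots> < ?d\<^sup>2" using h d v by simp
      finally have "norm (h *\<^sub>R v - ?d *\<^sub>R n) < ?d" using d by (simp add: power2_less_imp_less)
      moreover have "a + h *\<^sub>R v - x = h *\<^sub>R v - ?d *\<^sub>R n" unfolding xa[symmetric] by simp
      ultimately have "dist (a + h *\<^sub>R v) x < ?d" by (simp only: dist_norm)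
      then have "a + h *\<^sub>R v \<in> ball x ?d" by (simp add: dist_commute)
      then have "a + h *\<^sub>R v \<in> \<Omega>" using ball_boundary_dist_subset[OF x] by blast
      moreover have "a + h *\<^sub>R v \<in> U" using e(2) h by (auto simp: subset_iff dist_norm)
      ultimately have "r (a + h *\<^sub>R v) < 0" using in_domain_iff by blast
      with d1(2)[OF h(1,2)] show False by simp
    qed
    have nn: "inner n n = 1" using n1 by (simp add: norm_eq_1)
    have Gn: "G a = - norm (G a) *\<^sub>R n"
    proof -
      \<comment> \<open>The part of the gradient orthogonal to \<open>n\<close>. Testing
        \<open>inward\<close> with \<open>w + t *\<^sub>R n\<close> for small positive
        \<open>t\<close> forces it to vanish.\<close>
      define w where "w = G a - inner (G a) n *\<^sub>R n"
      have wn: "inner w n = 0" by (simp add: w_def inner_diff_left nn)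
      have ww: "inner (G a) w = (norm w)\<^sup>2"
        using wn unfolding power2_norm_eq_inner
        by (simp add: w_def inner_diff_left inner_diff_right inner_commute nn algebra_simps)
      have "inner (G a) w \<le> t * - inner (G a) n" if t: "t > 0" for t
        using inward[of "w + t *\<^sub>R n"] wn nn t by (simp add: inner_add_left inner_add_right)
      then have le: "(norm w)\<^sup>2 \<le> t * - inner (G a) n" if "t > 0" for t using that by (simp only: ww)
      have "norm w = 0"
      proof (rule ccontr)
        assume w0: "norm w \<noteq> 0"
        \<comment> \<open>Chosen so that the right-hand side is at most half of
          \<open>(norm w)\<^sup>2\<close>.\<close>
        let ?t = "(norm w)\<^sup>2 / (2 * (\<bar>inner (G a) n\<bar> + 1))"
        have t: "?t > 0" using w0 by (intro divide_pos_pos) auto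
        have "(norm w)\<^sup>2 \<le> ?t * - inner (G a) n" by (rule le[OF t])
        also have "\<dots> \<le> ?t * (\<bar>inner (G a) n\<bar> + 1)" using t by (intro mult_left_mono) auto
        also have "\<dots> = (norm w)\<^sup>2 / 2" by (simp add: field_simps)
        finally show False using w0 by simp
      qed
      then have "G a = inner (G a) n *\<^sub>R n" by (simp add: w_def)
      moreover have "inner (G a) n \<le> 0" using inward[of n] nn by simp
      moreover have "norm (G a) = \<bar>inner (G a) n\<bar>" using calculation(1) n1
        by (metis mult.right_neutral norm_scaleR)
      ultimately show ?thesis by simp
    qed
    define p where "p = a + \<rho> *\<^sub>R n"
    have "p - x = (\<rho> - ?d) *\<^sub>R n" using xa by (simp add: p_def algebra_simps)
    then have px: "dist p x = \<rho> - ?d" using n1 xd by (simp add: dist_norm)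
    have "ball p \<rho> \<subseteq> \<Omega>"
    proof
      fix z assume z: "z \<in> ball p \<rho>"
      define w where "w = z - a"
      have "norm (w - \<rho> *\<^sub>R n) < \<rho>"
        using z by (simp add: w_def p_def dist_norm norm_minus_commute algebra_simps)
      then have "(norm (w - \<rho> *\<^sub>R n))\<^sup>2 < \<rho>\<^sup>2" using \<rho> by (intro power_strict_mono) auto
      moreover have "(norm (w - \<rho> *\<^sub>R n))\<^sup>2 = (norm w)\<^sup>2 - 2 * \<rho> * inner w n + \<rho>\<^sup>2"
        unfolding power2_norm_eq_inner
        using nn by (simp add: inner_diff_left inner_diff_right inner_commute power2_eq_square algebra_simps)
      \<comment> \<open>The ball in coordinates centred at its point of tangency \<open>a\<close>:
        the squared length is dominated by the normal component, which drives every later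
        estimate.\<close>
      ultimately have w2: "(norm w)\<^sup>2 < 2 * \<rho> * inner w n" by simp
      have "0 < 2 * \<rho> * inner w n" by (rule le_less_trans[OF zero_le_power2 w2])
      then have wn: "inner w n > 0" using \<rho>(1) by (simp add: zero_less_mult_iff)
      have "norm w * norm w < 2 * \<rho> * norm w"
        using w2 norm_cauchy_schwarz[of w n] n1 \<rho>(1) by (simp add: power2_eq_square) (smt (verit) mult_left_mono)
      then have "norm w \<le> \<sigma>" using \<rho>(2) by (smt (verit) mult_right_less_imp_less norm_ge_zero)
      then obtain y where y: "infdist y (frontier \<Omega>) \<le> \<sigma>"
        "r (a + w) = frechet_derivative r (at a) w + hess r y w w / 2"
        using Taylor_collar[OF \<sigma>(2) a(1)] by metis
      have "frechet_derivative r (at a) w = - norm (G a) * inner w n"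
        by (subst m(2)[OF a(1)], subst Gn) (simp add: inner_commute)
      also have "\<dots> \<le> - m * inner w n" using m(3)[OF a(1)] wn by simp
      finally have "frechet_derivative r (at a) w \<le> - m * inner w n" .
      moreover have "hess r y w w / 2 < M * \<rho> * inner w n"
      proof -
        have "hess r y w w \<le> M * (norm w)\<^sup>2" using hM[OF y(1)] .
        also have "\<dots> < M * (2 * \<rho> * inner w n)" using w2 M(1) by simp
        finally show ?thesis by simp
      qed
      moreover have "M * \<rho> * inner w n \<le> m * inner w n" using \<rho>(3) wn by simp
      ultimately have "r (a + w) < 0" using y(2) by simp
      moreover have "a + w \<in> U"
        using infdist_le[OF a(1), of "a + w"] \<open>norm w \<le> \<sigma>\<close> \<sigma>(2) by (auto simp: dist_norm)
      ultimately show "z \<in> \<Omega>" using in_domain_iff[of "a + w"] by (simp add: w_def)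
    qed
    with px show ?thesis by blast
  qed
  with \<rho>(1) show thesis using that by blast
qed

end

section \<open>Discs in strongly linearly convex domains\<close>

text \<open>Harnack's inequality for \<open>- ln (cmod (h z))\<close>, obtained from the Schwarz
  lemma applied to a logarithm \<open>g\<close> of \<open>h\<close>. The radius 1/3 is the one for
  which the Harnack factor \<open>(1 - 1/3) / (1 + 1/3)\<close> equals 1/2, hence the square
  root.\<close>

lemma nonvanishing_disc_function_bound:
  assumes h: "h holomorphic_on ball 0 1"
    and h1: "\<And>z. z \<in> ball 0 1 \<Longrightarrow> cmod (h z) < 1"
    and h0: "\<And>z. z \<in> ball 0 1 \<Longrightarrow> h z \<noteq> 0"
    and z: "cmod z \<le> 1/3"
  shows "cmod (h z) \<le> sqrt (cmod (h 0))"
proof -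
  have "contractible (ball (0::complex) 1)" by (intro convex_imp_contractible convex_ball)
  then obtain g where g: "g holomorphic_on ball 0 1" "\<And>z. z \<in> ball 0 1 \<Longrightarrow> h z = exp (g z)"
    using contractible_imp_holomorphic_log[OF h _ h0] by metis
  have neg: "Re (g w) < 0" if "w \<in> ball 0 1" for w
    using h1[OF that] g(2)[OF that] by simp
  define g0 where "g0 = g 0"
  have g0: "Re g0 < 0" using neg[of 0] by (simp add: g0_def)
  \<comment> \<open>A Cayley transform turns \<open>g\<close> into a self-map of the disc that fixes the origin.\<close>
  define m where "m w = (g w - g0) / (g w + cnj g0)" for w
  have nz: "g w + cnj g0 \<noteq> 0" if "w \<in> ball 0 1" for w
    using neg[OF that] g0 by (auto simp: complex_eq_iff)
  have "m holomorphic_on ball 0 1"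
    unfolding m_def by (intro holomorphic_intros g nz)
  moreover have "m 0 = 0" by (simp add: m_def g0_def)
  moreover have "cmod (m w) < 1" if "cmod w < 1" for w
  proof -
    have w: "w \<in> ball 0 1" using that by simp
    have "0 < Re (g w) * Re g0" using neg[OF w] g0 by (simp add: mult_neg_neg)
    then have "(cmod (g w - g0))\<^sup>2 < (cmod (g w + cnj g0))\<^sup>2"
      unfolding cmod_power2 by (simp add: power2_eq_square algebra_simps)
    then have "cmod (g w - g0) < cmod (g w + cnj g0)" by (rule power2_less_imp_less) simp
    then show ?thesis using nz[OF w] by (simp add: m_def norm_divide)
  qed
  ultimately have "cmod (m z) \<le> cmod z" using z by (intro Schwarz_Lemma(1)) auto
  then have "cmod (m z) \<le> 1/3" using z by linarith
  moreover have zb: "z \<in> ball 0 1" using z by simp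
  ultimately have "3 * cmod (g z - g0) \<le> cmod (g z + cnj g0)"
    using nz[OF zb] by (simp add: m_def norm_divide field_simps)
  then have "(3 * cmod (g z - g0))\<^sup>2 \<le> (cmod (g z + cnj g0))\<^sup>2" by (intro power_mono) auto
  then have "9 * ((Re (g z) - Re g0)\<^sup>2 + (Im (g z) - Im g0)\<^sup>2)
      \<le> (Re (g z) + Re g0)\<^sup>2 + (Im (g z) - Im g0)\<^sup>2"
    unfolding power_mult_distrib cmod_power2 by simp
  then have "9 * (Re (g z) - Re g0)\<^sup>2 \<le> (Re (g z) + Re g0)\<^sup>2"
    using zero_le_power2[of "Im (g z) - Im g0"] unfolding distrib_left by linarith
  \<comment> \<open>Both real parts are negative, so the nonnegative root on the right is minus
    their sum.\<close>
  then have "(3 * (Re (g z) - Re g0))\<^sup>2 \<le> (- (Re (g z) + Re g0))\<^sup>2"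
    unfolding power_mult_distrib power2_minus by simp
  then have "3 * (Re (g z) - Re g0) \<le> - (Re (g z) + Re g0)"
    by (rule power2_le_imp_le) (use neg[OF zb] g0 in linarith)
  then have "Re (g z) \<le> Re g0 / 2" unfolding right_diff_distrib by linarith
  then have "exp (Re (g z)) \<le> exp (Re g0 / 2)" by simp
  also have "\<dots> = sqrt (exp (Re g0))"
    by (rule real_sqrt_unique[symmetric]) (simp_all flip: exp_of_nat_mult)
  finally show ?thesis using g(2)[OF zb] g(2)[of 0] by (simp add: g0_def)
qed

context C2_domain
begin

text \<open>The exponent 1/4 arises from two square roots: one from the Harnack estimate for the
  nonvanishing tangent form, one from its quadratic contact with the boundary.\<close>

lemma holomorphic_disc_deriv_bound:
  assumes lc: "linearly_convex \<Omega>"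
    and pos: "\<And>a X. a \<in> frontier \<Omega> \<Longrightarrow> X \<noteq> 0 \<Longrightarrow> tangent_form r a X = 0 \<Longrightarrow> 0 < hess r a X X"
  obtains C \<delta> where "C > 0" "\<delta> > 0"
    "\<And>f i. holomorphic_disc \<Omega> f \<Longrightarrow> boundary_dist \<Omega> (f 0) < \<delta> \<Longrightarrow>
       cmod (deriv (\<lambda>z. f z $ i) 0) \<le> C * boundary_dist \<Omega> (f 0) powr (1/4)"
proof -
  obtain c \<sigma> where c: "c > 0" "\<sigma> > 0"
    "\<And>a z. a \<in> frontier \<Omega> \<Longrightarrow> z \<in> \<Omega> \<Longrightarrow> dist z a < \<sigma> \<Longrightarrow>
       c * (dist z a)\<^sup>2 \<le> cmod (tangent_form r a (z - a))"
    by (rule tangent_form_contact[OF pos]) blast+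
  obtain M where M: "M > 0" "\<And>a w. a \<in> frontier \<Omega> \<Longrightarrow> cmod (tangent_form r a w) \<le> M * norm w"
    using tangent_form_bound by metis
  have "bounded (closure \<Omega>)" using domain by (simp add: bounded_domain_def bounded_closure)
  then obtain R where R: "\<And>x y. x \<in> closure \<Omega> \<Longrightarrow> y \<in> closure \<Omega> \<Longrightarrow> dist x y \<le> R"
    unfolding bounded_two_points by blast
  \<comment> \<open>A strict bound for the tangent form over the domain; division by it gives a
    function into the open unit disc.\<close>
  define D where "D = M * \<bar>R\<bar> + 1"
  have D: "D > 0" using M(1) by (simp add: D_def add_nonneg_pos)
  \<comment> \<open>Solves \<open>c * (C * d powr (1/4))\<^sup>2 = sqrt (D * M * d)\<close>, the
    equality of the contact bound and the Harnack bound.\<close>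
  define C where "C = sqrt (sqrt (D * M) / c)"
  have C: "C > 0" using D M(1) c(1) by (simp add: C_def)
  \<comment> \<open>The first bound starts the disc within \<open>\<sigma> / 2\<close> of
    \<open>a\<close>, the second makes \<open>\<eta>\<close> smaller than
    \<open>\<sigma> / 2\<close>.\<close>
  define \<delta> where "\<delta> = min (\<sigma> / 2) ((\<sigma> / (2 * C)) ^ 4)"
  have \<delta>: "\<delta> > 0" using c C by (simp add: \<delta>_def)
  have "cmod (deriv (\<lambda>z. f z $ i) 0) \<le> 6 * C * boundary_dist \<Omega> (f 0) powr (1/4)"
    if f: "holomorphic_disc \<Omega> f" and fd: "boundary_dist \<Omega> (f 0) < \<delta>" for f i
  proof -
    let ?d = "boundary_dist \<Omega> (f 0)"
    have in\<Omega>: "f z \<in> \<Omega>" if "z \<in> ball 0 1" for z using f that by (auto simp: holomorphic_disc_def)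
    have hol: "(\<lambda>z. f z $ j) holomorphic_on ball 0 1" for j using f by (simp add: holomorphic_disc_def)
    have d: "0 < ?d" using boundary_dist_pos[OF domain in\<Omega>] by simp
    obtain a where a: "a \<in> frontier \<Omega>" "?d = dist (f 0) a" using nearest_frontier_point .
    define \<eta> where "\<eta> = C * ?d powr (1/4)"
    have \<eta>: "0 < \<eta>" using C d by (simp add: \<eta>_def)
    have root: "?d powr (1/4) = sqrt (sqrt ?d)"
      using d by (simp add: powr_powr flip: powr_half_sqrt)
    have "?d < (\<sigma> / (2 * C)) ^ 4" using fd by (simp add: \<delta>_def)
    then have "?d powr (1/4) < ((\<sigma> / (2 * C)) ^ 4) powr (1/4)" using d by (intro powr_less_mono2) auto
    also have "(\<sigma> / (2 * C)) ^ 4 = (\<sigma> / (2 * C)) powr 4"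
      using powr_realpow[of "\<sigma> / (2 * C)" 4] c(2) C by simp
    also have "\<dots> powr (1/4) = \<sigma> / (2 * C)"
      unfolding powr_powr using c(2) C by simp
    finally have \<eta>\<sigma>: "\<eta> < \<sigma> / 2" using C by (simp add: \<eta>_def field_simps)
    define h where "h z = tangent_form r a (f z - a) / of_real D" for z
    have "h holomorphic_on ball 0 1"
      unfolding h_def tangent_form_def using D by (auto intro!: holomorphic_intros hol)
    moreover have "cmod (h z) < 1" if "z \<in> ball 0 1" for z
    proof -
      have "f z \<in> closure \<Omega>" "a \<in> closure \<Omega>"
        using in\<Omega>[OF that] a(1) closure_subset by (auto simp: frontier_def)
      then have "norm (f z - a) \<le> \<bar>R\<bar>" using R[of "f z" a] by (simp add: dist_norm)
      then have "M * norm (f z - a) \<le> M * \<bar>R\<bar>" using M(1) by (intro mult_left_mono) auto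
      then have "M * norm (f z - a) < D" by (simp add: D_def)
      then show ?thesis using M(2)[OF a(1), of "f z - a"] D by (simp add: h_def norm_divide)
    qed
    moreover have "h z \<noteq> 0" if "z \<in> ball 0 1" for z
      using tangent_form_nonvanishing[OF lc a(1) in\<Omega>[OF that]] D by (simp add: h_def)
    ultimately have h: "cmod (h z) \<le> sqrt (cmod (h 0))" if "cmod z \<le> 1/3" for z
      using that by (rule nonvanishing_disc_function_bound)
    have small: "cmod (tangent_form r a (f z - a)) \<le> c * \<eta>\<^sup>2" if "cmod z \<le> 1/3" for z
    proof -
      have "cmod (h 0) \<le> M * ?d / D"
        using M(2)[OF a(1), of "f 0 - a"] D a(2)
        by (simp add: h_def norm_divide dist_norm divide_right_mono)
      then have "cmod (h z) \<le> sqrt (M * ?d / D)" using h[OF that] by (meson order_trans real_sqrt_le_mono)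
      then have "cmod (tangent_form r a (f z - a)) \<le> D * sqrt (M * ?d / D)"
        using D by (simp add: h_def norm_divide field_simps)
      also have "\<dots> = sqrt (D\<^sup>2 * (M * ?d / D))" using D unfolding real_sqrt_mult[of "D\<^sup>2"] by simp
      also have "D\<^sup>2 * (M * ?d / D) = D * M * ?d" using D by (simp add: power2_eq_square)
      also have "sqrt (D * M * ?d) = c * \<eta>\<^sup>2"
        using c(1) D M(1) d by (simp add: \<eta>_def root C_def power_mult_distrib real_sqrt_mult)
      finally show ?thesis .
    qed
    have near: "dist (f z) a \<le> \<eta>" if "cmod z \<le> 1/3" "dist (f z) a < \<sigma>" for z
    proof -
      have "z \<in> ball 0 1" using that(1) by simp
      from order_trans[OF c(3)[OF a(1) in\<Omega>[OF this] that(2)] small[OF that(1)]]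
      have "c * (dist (f z) a)\<^sup>2 \<le> c * \<eta>\<^sup>2" .
      then have "(dist (f z) a)\<^sup>2 \<le> \<eta>\<^sup>2" using c(1) by simp
      then show ?thesis by (rule power2_le_imp_le) (use \<eta> in simp)
    qed
    have contf: "continuous_on (ball 0 1) f"
    proof -
      have "continuous_on (ball 0 1) (\<lambda>z. \<chi> j. f z $ j)"
        by (intro continuous_intros holomorphic_on_imp_continuous_on hol)
      then show ?thesis by simp
    qed
    \<comment> \<open>By connectedness the disc cannot leave the region where the contact estimate is valid.\<close>
    have stay: "dist (f z) a \<le> \<eta>" if z: "cmod z \<le> 1/3" for z
    proof (rule ccontr)
      assume "\<not> dist (f z) a \<le> \<eta>"
      then have far: "\<sigma> \<le> dist (f z) a" using near[OF z] by fastforce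
      have zt: "cmod (of_real t * z) \<le> 1/3" if "0 \<le> t" "t \<le> 1" for t
        using z that mult_mono[of t 1 "cmod z" "1/3"] by (simp add: norm_mult)
      have "continuous_on {0..1} (\<lambda>t. dist (f (of_real t * z)) a)"
      proof (intro continuous_intros continuous_on_compose2[OF contf])
        show "(\<lambda>t. of_real t * z) ` {0..1} \<subseteq> ball 0 1" using zt by force
      qed
      moreover have "dist (f (of_real 0 * z)) a \<le> \<sigma> / 2"
        using fd a(2) by (simp add: \<delta>_def)
      moreover have "\<sigma> / 2 \<le> dist (f (of_real 1 * z)) a" using far c(2) by simp
      \<comment> \<open>At distance exactly \<open>\<sigma> / 2\<close> the contact estimate already
        applies and improves the distance to \<open>\<eta> < \<sigma> / 2\<close>, a
        contradiction.\<close>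
      ultimately obtain t where t: "0 \<le> t" "t \<le> 1" "dist (f (of_real t * z)) a = \<sigma> / 2"
        using IVT'[of "\<lambda>t. dist (f (of_real t * z)) a" 0 "\<sigma> / 2" 1] by auto
      then show False using near[OF zt[OF t(1,2)]] \<eta>\<sigma> c(2) by simp
    qed
    \<comment> \<open>Cauchy's estimate on radius 1/3 asks for an open target ball, hence
      \<open>2 * \<eta>\<close> in place of \<open>\<eta>\<close> and the factor 6.\<close>
    have "cmod ((deriv ^^ 1) (\<lambda>z. f z $ i) 0) \<le> fact 1 * (2 * \<eta>) / (1/3) ^ 1"
    proof (rule Cauchy_higher_deriv_bound[where y = "a $ i"])
      show "(\<lambda>z. f z $ i) holomorphic_on ball 0 (1/3)"
        by (rule holomorphic_on_subset[OF hol]) auto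
      show "continuous_on (cball 0 (1/3)) (\<lambda>z. f z $ i)"
        by (rule continuous_on_subset[OF holomorphic_on_imp_continuous_on[OF hol]]) auto
      fix w :: complex assume "w \<in> ball 0 (1/3)"
      then have "dist (f w) a \<le> \<eta>" by (intro stay) simp
      then have "dist (f w $ i) (a $ i) \<le> \<eta>" by (rule order_trans[OF dist_vec_nth_le])
      then show "f w $ i \<in> ball (a $ i) (2 * \<eta>)" using \<eta> by (simp add: dist_commute)
    qed auto
    then show ?thesis by (simp add: \<eta>_def)
  qed
  then show thesis using that[of "6 * C" \<delta>] C \<delta> by simp
qed

text \<open>A disc competing for a unit vector \<open>v\<close> at \<open>x\<close> has small
  derivative at 0, so its scalar \<open>\<xi>\<close> must be large. This bounds the metric from
  below, and taking reciprocals bounds \<open>M_Omega\<close>.\<close>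

lemma M_Omega_bound:
  assumes lc: "linearly_convex \<Omega>"
    and pos: "\<And>a X. a \<in> frontier \<Omega> \<Longrightarrow> X \<noteq> 0 \<Longrightarrow> tangent_form r a X = 0 \<Longrightarrow> 0 < hess r a X X"
  obtains C \<delta> where "C > 0" "\<delta> > 0"
    "\<And>t. t < \<delta> \<Longrightarrow> M_Omega \<Omega> t \<le> ennreal (C * t powr (1/4))"
proof -
  obtain C \<delta> where C: "C > 0" "\<delta> > 0"
    "\<And>f i. holomorphic_disc \<Omega> f \<Longrightarrow> boundary_dist \<Omega> (f 0) < \<delta> \<Longrightarrow>
       cmod (deriv (\<lambda>z. f z $ i) 0) \<le> C * boundary_dist \<Omega> (f 0) powr (1/4)"
    by (rule holomorphic_disc_deriv_bound[OF lc pos]) blast+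
  \<comment> \<open>The dimension enters when the Euclidean norm is estimated by the sum of the
    coordinate moduli.\<close>
  define B where "B = real CARD('n) * C"
  have B: "B > 0" using C(1) by (simp add: B_def)
  have "M_Omega \<Omega> t \<le> ennreal (B * t powr (1/4))" if t: "t < \<delta>" for t
    unfolding M_Omega_def
  proof (rule Sup_least)
    fix y assume "y \<in> {1 / ennreal (kobayashi_metric \<Omega> x v) | x v.
            x \<in> \<Omega> \<and> boundary_dist \<Omega> x \<le> t \<and> norm v = 1}"
    then obtain x v where y: "y = 1 / ennreal (kobayashi_metric \<Omega> x v)" and x: "x \<in> \<Omega>"
      "boundary_dist \<Omega> x \<le> t" and v: "norm v = 1" by blast
    let ?d = "boundary_dist \<Omega> x"
    have d: "0 < ?d" using boundary_dist_pos[OF domain x(1)] .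
    have bd: "0 < B * ?d powr (1/4)" using B d by simp
    have "1 / (B * ?d powr (1/4)) \<le> kobayashi_metric \<Omega> x v"
      unfolding kobayashi_metric_def
    proof (rule cInf_greatest)
      \<comment> \<open>A lower bound for an infimum of reals is meaningful only over a nonempty
        set; an affine disc in a small ball supplies an element.\<close>
      obtain e where e: "e > 0" "ball x e \<subseteq> \<Omega>" using x(1) frontier_facts(3) openE by blast
      have "holomorphic_disc \<Omega> (\<lambda>\<zeta>. \<chi> i. x $ i + \<zeta> * (e *\<^sub>R v) $ i)"
        by (rule holomorphic_disc_affine[OF e(2)]) (use e v in auto)
      moreover have "deriv (\<lambda>z. (\<chi> i. x $ i + z * (e *\<^sub>R v) $ i) $ j) 0 * of_real (1 / e) = v $ j" for j
      proof -
        have "((\<lambda>z. x $ j + z * (e *\<^sub>R v) $ j) has_field_derivative (e *\<^sub>R v) $ j) (at 0)"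
          by (auto intro!: derivative_eq_intros)
        moreover have "(e *\<^sub>R v) $ j * of_real (1 / e) = v $ j"
          using e(1) by (simp add: scaleR_eq_vector_scalar_mult)
        ultimately show ?thesis by (simp add: DERIV_imp_deriv)
      qed
      moreover have "(\<chi> i. x $ i + 0 * (e *\<^sub>R v) $ i) = x" by (simp add: vec_eq_iff)
      ultimately show "{cmod \<xi> | \<xi> f. holomorphic_disc \<Omega> f \<and> f 0 = x \<and>
          (\<forall>i. deriv (\<lambda>z. f z $ i) 0 * \<xi> = v $ i)} \<noteq> {}" by blast
    next
      fix s assume "s \<in> {cmod \<xi> | \<xi> f. holomorphic_disc \<Omega> f \<and> f 0 = x \<and>
          (\<forall>i. deriv (\<lambda>z. f z $ i) 0 * \<xi> = v $ i)}"
      then obtain \<xi> f where f: "s = cmod \<xi>" "holomorphic_disc \<Omega> f" "f 0 = x"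
        "\<And>i. deriv (\<lambda>z. f z $ i) 0 * \<xi> = v $ i" by blast
      have "cmod (v $ i) \<le> C * ?d powr (1/4) * s" for i
        using C(3)[OF f(2), of i] f(1,3) x(2) t by (simp add: norm_mult mult_right_mono flip: f(4))
      then have "(\<Sum>i\<in>UNIV. cmod (v $ i)) \<le> (\<Sum>i\<in>(UNIV :: 'n set). C * ?d powr (1/4) * s)"
        by (rule sum_mono)
      moreover have "norm v \<le> (\<Sum>i\<in>UNIV. cmod (v $ i))" unfolding norm_vec_def by (rule L2_set_le_sum) auto
      ultimately have "1 \<le> s * (B * ?d powr (1/4))" using v by (simp add: B_def mult_ac)
      then show "1 / (B * ?d powr (1/4)) \<le> s" using bd by (simp add: divide_le_eq)
    qed
    then have "y \<le> 1 / ennreal (1 / (B * ?d powr (1/4)))"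
      unfolding y divide_ennreal_def by (intro mult_left_mono ennreal_inverse_antimono ennreal_leI) auto
    also have "\<dots> = ennreal (B * ?d powr (1/4))"
      using bd by (simp add: divide_ennreal flip: ennreal_1)
    also have "\<dots> \<le> ennreal (B * t powr (1/4))"
      using B d x(2) by (intro ennreal_leI mult_left_mono powr_mono2) auto
    finally show "y \<le> ennreal (B * t powr (1/4))" .
  qed
  then show thesis using that B C(2) by blast
qed

end

text \<open>The integrand is dominated by a multiple of \<open>t powr (-3/4)\<close>, which is
  integrable at 0, and the growth of the distance follows from interior balls of uniform
  radius.\<close>

theorem strongly_linearly_convex_imp_goldilocks:
  fixes \<Omega> :: "(complex ^ 'n) set"
  assumes "strongly_linearly_convex \<Omega>"
  shows "goldilocks \<Omega>"
proof -
  have dom: "bounded_domain \<Omega>" and lc: "linearly_convex \<Omega>"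
    using assms by (auto simp: strongly_linearly_convex_def)
  obtain U r where U: "defining_function \<Omega> U r" "Ck_on 2 U r"
    and levi: "\<And>a X. a \<in> frontier \<Omega> \<Longrightarrow> X \<noteq> 0 \<Longrightarrow>
       (\<Sum>j\<in>UNIV. wirtinger j (\<lambda>z. complex_of_real (r z)) a * X $ j) = 0 \<Longrightarrow>
       cmod (\<Sum>j\<in>UNIV. \<Sum>k\<in>UNIV. wirtinger j (wirtinger k (\<lambda>z. complex_of_real (r z))) a * X $ j * X $ k)
       < Re (\<Sum>j\<in>UNIV. \<Sum>k\<in>UNIV. wirtinger j (wirtinger_bar k (\<lambda>z. complex_of_real (r z))) a * X $ j * cnj (X $ k))"
    using assms unfolding strongly_linearly_convex_def Let_def by blast
  interpret C2_domain \<Omega> U r by unfold_locales (fact dom U)+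
  \<comment> \<open>The holomorphic quadratic form can lower the Hessian by at most twice its
    modulus, and the Levi form strictly exceeds that modulus.\<close>
  have pos: "0 < hess r a X X" if "a \<in> frontier \<Omega>" "X \<noteq> 0" "tangent_form r a X = 0" for a X
  proof -
    let ?s = "\<Sum>j\<in>UNIV. \<Sum>k\<in>UNIV. wirtinger j (wirtinger k (\<lambda>z. complex_of_real (r z))) a * X $ j * X $ k"
    have "- cmod ?s \<le> Re ?s" using abs_Re_le_cmod[of ?s] by linarith
    with levi[OF that(1,2) that(3)[unfolded tangent_form_def]]
    show ?thesis unfolding hess_eq_wirtinger[OF open_U C2 frontier_U[OF that(1)]] by linarith
  qed
  obtain C \<delta> where C: "C > 0" "\<delta> > 0"
    "\<And>t. t < \<delta> \<Longrightarrow> M_Omega \<Omega> t \<le> ennreal (C * t powr (1/4))"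
    by (rule M_Omega_bound[OF lc pos]) blast+
  have "(\<integral>\<^sup>+t\<in>{0<..<\<delta>}. (1 / ennreal t * M_Omega \<Omega> t) \<partial>lborel)
      \<le> (\<integral>\<^sup>+t. ennreal (C * t powr (-3/4)) * indicator {0..\<delta>} t \<partial>lborel)"
  proof (rule nn_integral_mono)
    fix t :: real
    show "1 / ennreal t * M_Omega \<Omega> t * indicator {0<..<\<delta>} t
        \<le> ennreal (C * t powr (-3/4)) * indicator {0..\<delta>} t"
    proof (cases "t \<in> {0<..<\<delta>}")
      case True
      then have t: "0 < t" "t < \<delta>" by auto
      have "1 / ennreal t * M_Omega \<Omega> t \<le> ennreal (1 / t) * ennreal (C * t powr (1/4))"
        using C(3)[OF t(2)] t(1)
        by (intro mult_mono) (auto simp: divide_ennreal simp flip: ennreal_1)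
      also have "\<dots> = ennreal (1 / t * (C * t powr (1/4)))" using t by (intro ennreal_mult[symmetric]) (use C in auto)
      also have "1 / t * (C * t powr (1/4)) = C * t powr (-3/4)"
        using powr_diff[of t "1/4" 1] t by simp
      finally show ?thesis using t by simp
    qed simp
  qed
  also have "\<dots> < \<infinity>"
  proof -
    have "((\<lambda>t. C * t powr (-3/4)) has_integral C * (\<delta> powr (-3/4 + 1) / (-3/4 + 1))) {0..\<delta>}"
      using C(2) by (intro has_integral_mult_right has_integral_powr_from_0) auto
    from nn_integral_has_integral_lebesgue'[OF _ this] show ?thesis using C(1) by simp
  qed
  finally have "\<exists>\<epsilon>>0. (\<integral>\<^sup>+t\<in>{0<..<\<epsilon>}. (1 / ennreal t * M_Omega \<Omega> t) \<partial>lborel) < \<infinity>"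
    using C(2) by blast
  moreover obtain \<rho> where "\<rho> > 0" "\<And>x. x \<in> \<Omega> \<Longrightarrow> boundary_dist \<Omega> x < \<rho> \<Longrightarrow>
       \<exists>p. ball p \<rho> \<subseteq> \<Omega> \<and> dist p x = \<rho> - boundary_dist \<Omega> x"
    using interior_balls by metis
  ultimately show ?thesis
    using dom kobayashi_dist_le_of_interior_balls[OF dom] unfolding goldilocks_def by blast
qed

theorem corollary2p13:
  fixes \<Omega> :: "(complex ^ 'n) set" and \<phi> :: "complex \<Rightarrow> complex ^ 'n"
  assumes "CARD('n) \<ge> 2"
    and "bounded_domain \<Omega>"
    and "(convex \<Omega> \<and> goldilocks \<Omega>) \<or> (smoothly_bounded \<Omega> \<and> strongly_linearly_convex \<Omega>)"
    and "complex_geodesic \<Omega> \<phi>"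
  shows "\<exists>\<psi>. continuous_on (cball 0 1) \<psi> \<and> \<psi> ` cball 0 1 \<subseteq> closure \<Omega> \<and>
             (\<forall>z\<in>ball 0 1. \<psi> z = \<phi> z)"
proof -
  have "goldilocks \<Omega>" using assms(3) strongly_linearly_convex_imp_goldilocks by blast
  then show ?thesis using assms(4) by (rule goldilocks_geodesic_extends)
qed

end
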